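(* Let $\alpha\in(0,1)$, $b\in(0,1]$, $T>0$, let $\{X_t\}_{0\le t\le T}\sim\mathrm{ML}(\alpha,b,T)$ and $\nabla X_t=X_t-X_{t-d}$, where $d>0$; all times satisfy $d\le t<s\le T$. (i) For $s-t>d$, $$\mathrm E(\nabla X_t\nabla X_s)=\frac{bT^{\alpha-1}}{\Gamma(\alpha)\Gamma(\alpha+2)}\big((s-t+d)^{\alpha+1}-2(s-t)^{\alpha+1}+(s-t-d)^{\alpha+1}\big).$$ As $d=\Delta\to0$, with $c'=bT^{\alpha-1}/\Gamma(\alpha)^2$ and $c''=2/(\alpha(\alpha+1))$, $$\mathrm E(\nabla X_t\nabla X_s)\sim\Delta^2c'(s-t)^{\alpha-1},\qquad\mathrm{cov}(\nabla X_t,\nabla X_s)\sim\Delta^2c'\big((s-t)^{\alpha-1}-bT^{\alpha-1}\big),\qquad\mathrm{corr}(\nabla X_t,\nabla X_s)\sim\frac{(s-t)^{\alpha-1}-bT^{\alpha-1}}{c''\Delta^{\alpha-1}-bT^{\alpha-1}} .$$ (ii) For $0<s-t<d$, as $s-t\to0$, $$\mathrm{corr}(\nabla X_t,\nabla X_s)\sim1-c'(s-t)^{\alpha+1},\qquad c'=\frac{2bT^{\alpha-1}}{\Gamma(\alpha)\Gamma(\alpha+2)\,\mathrm{var}(\nabla X_t)} .$$ (iii) For any $m\in\mathbb N$, $0<t_1<\cdots<t_m\le T$ and $k_1,\dots,k_m\in\mathbb N$, $$\lim_{d\to0}\frac{\mathrm E\big(\prod_{i=1}^m(\nabla X_{t_i})^{k_i}\big)}{\prod_{i=1}^m\mathrm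 E\big((\nabla X_{t_i})^{k_i}\big)}=\prod_{i=2}^m\frac{(t_i-t_{i-1})^{\alpha-1}}{c'},\qquad c'=bT^{\alpha-1}.$$
   Context: $u\sim v$ denotes asymptotic equivalence: $u/v\to1$ in the indicated limit. The Mittag-Leffler process $\mathrm{ML}(\alpha,b,T)$ is the process $X$ on $[0,T]$ with $X_0=0$ and stationary increments whose finite-dimensional laws are determined as follows. Let $c=1/\Gamma(\alpha)$, $a_T=bT^{\alpha-1}/\Gamma(\alpha)$. For $0=t_0<t_1<\cdots<t_m\le T$, $s_j\in\mathbb R$, $S_i=\sum_{j=i}^ms_j$, $$\mathrm E\big(e^{s_1X_{t_1}+\cdots+s_mX_{t_m}}\big)=1+a_T\sum_{\emptyset\ne C\subset\{1,\dots,m\}}\sum_{k_1,\dots,k_{|C|}\in\mathbb N}t_{C(|C|)}^{\alpha(\sum_ik_i-1)+1}\Big(\prod_{i=1}^{|C|}S_{C(i)}^{k_i}\Big)A(C,\{k_i\}),$$ where $C(i)$ is the $i$-th smallest element of $C$ and, with $q=|C|$, $\tau=t_{C(q)}$, $C_1=\{i\le q:k_i=1\}$, $C_2=\{i\le q:k_i\ge2\}$, $$A(C,\{k_i\})=\int_{Q_C}\Big\{\tfrac{(x_1-x_1')^{\alpha(k_1-1)-1}}{\Gamma((k_1-1)\alpha)}\Big\}^{I(k_1>1)}\prod_{i\in C_2,i\ge2}\Big\{c(x_i'-x_{i-1})^{\alpha-1}\tfrac{(x_i-x_i')^{\alpha(k_i-1)-1}}{\Gamma((k_i-1)\alpha)}\Big\}\prod_{j\in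 C_1,j\ge2}\{c(x_j-x_{j-1})^{\alpha-1}\}\,dx'\,dx,$$ integrating over $Q_C$: $t_{C(i)-1}/\tau<x_i'<x_i<t_{C(i)}/\tau$ for $i\in C_2$, $t_{C(j)-1}/\tau<x_j<t_{C(j)}/\tau$ for $j\in C_1$ ($t_{C(i)-1}$ is $t_r$ with $r=C(i)-1$). Equivalently, it is the EML$(\alpha,\lambda,b,T)$ process with $\lambda=0$; its marginal mgf is $\mathrm E(e^{sX_t})=1+s\,a_T\,t\,E_{\alpha,2}(st^\alpha)$ with $E_{\alpha,\beta}(z)=\sum_{k\ge0}z^k/\Gamma(k\alpha+\beta)$. *)

theory Defs
  imports "HOL-Probability.Probability" "HOL-Library.Landau_Symbols"
begin

text \<open>
  The \<open>i\<close>-th smallest element of a finite set of naturals, counted from \<open>i = 1\<close>.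
\<close>

definition nth_elem :: "nat set \<Rightarrow> nat \<Rightarrow> nat" where
  "nth_elem C i = sorted_list_of_set C ! (i - 1)"

text \<open>
  In the next definitions \<open>C\<close> is a nonempty subset of \<open>{1..m}\<close> with \<open>q\<close> elements, and
  \<open>k 1, \<dots>, k q\<close> are positive integers. A point of the domain of integration is a pair \<open>(x', x)\<close>
  of coordinate vectors: \<open>x\<close> is indexed by \<open>{1..q}\<close>, while \<open>x'\<close> is indexed only by the
  positions \<open>i\<close> with \<open>k i \<ge> 2\<close>.
\<close>

definition mlp_integrand ::
    "real \<Rightarrow> nat \<Rightarrow> (nat \<Rightarrow> nat) \<Rightarrow> (nat \<Rightarrow> real) \<times> (nat \<Rightarrow> real) \<Rightarrow> real" where
  "mlp_integrand \<alpha> q k = (\<lambda>(x', x).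
     (if k 1 > 1
      then (x 1 - x' 1) powr (\<alpha> * (real (k 1) - 1) - 1) / Gamma ((real (k 1) - 1) * \<alpha>)
      else 1) *
     (\<Prod>i\<in>{i \<in> {2..q}. k i \<ge> 2}.
        1 / Gamma \<alpha> * (x' i - x (i - 1)) powr (\<alpha> - 1) *
        ((x i - x' i) powr (\<alpha> * (real (k i) - 1) - 1) / Gamma ((real (k i) - 1) * \<alpha>))) *
     (\<Prod>j\<in>{j \<in> {2..q}. k j = 1}.
        1 / Gamma \<alpha> * (x j - x (j - 1)) powr (\<alpha> - 1)))"

definition mlp_region ::
    "(nat \<Rightarrow> real) \<Rightarrow> nat set \<Rightarrow> (nat \<Rightarrow> nat) \<Rightarrow> ((nat \<Rightarrow> real) \<times> (nat \<Rightarrow> real)) set" where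
  "mlp_region t C k =
     (let q = card C; \<tau> = t (nth_elem C q) in
      {(x', x).
        (\<forall>i\<in>{i \<in> {1..q}. k i \<ge> 2}.
           t (nth_elem C i - 1) / \<tau> < x' i \<and> x' i < x i \<and> x i < t (nth_elem C i) / \<tau>) \<and>
        (\<forall>j\<in>{j \<in> {1..q}. k j = 1}.
           t (nth_elem C j - 1) / \<tau> < x j \<and> x j < t (nth_elem C j) / \<tau>)})"

definition mlp_coeff :: "real \<Rightarrow> (nat \<Rightarrow> real) \<Rightarrow> nat set \<Rightarrow> (nat \<Rightarrow> nat) \<Rightarrow> real" where
  "mlp_coeff \<alpha> t C k =
     set_lebesgue_integral
       (PiM {i \<in> {1..card C}. k i \<ge> 2} (\<lambda>_. lborel) \<Otimes>\<^sub>M PiM {1..card C} (\<lambda>_. lborel))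
       (mlp_region t C k) (mlp_integrand \<alpha> (card C) k)"

definition mlp_term ::
    "real \<Rightarrow> nat \<Rightarrow> (nat \<Rightarrow> real) \<Rightarrow> (nat \<Rightarrow> real) \<Rightarrow> nat set \<Rightarrow> (nat \<Rightarrow> nat) \<Rightarrow> real" where
  "mlp_term \<alpha> m t s C k =
     t (nth_elem C (card C)) powr (\<alpha> * ((\<Sum>i=1..card C. real (k i)) - 1) + 1) *
     (\<Prod>i=1..card C. (\<Sum>j=nth_elem C i..m. s j) ^ k i) *
     mlp_coeff \<alpha> t C k"

text \<open>
  Exponent vectors \<open>(k 1, \<dots>, k q)\<close> with positive entries; extensionality makes each vector
  occur exactly once in the sum.
\<close>

abbreviation mlp_exponents :: "nat \<Rightarrow> (nat \<Rightarrow> nat) set" where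
  "mlp_exponents q \<equiv> {1..q} \<rightarrow>\<^sub>E {1..}"

text \<open>
  Stationarity of the increments of a process on \<open>[0,T]\<close>: the joint law of finitely many
  successive increments is invariant under time shifts that stay within \<open>[0,T]\<close>.
\<close>

definition stationary_increments :: "'a measure \<Rightarrow> real \<Rightarrow> (real \<Rightarrow> 'a \<Rightarrow> real) \<Rightarrow> bool" where
  "stationary_increments M T X \<longleftrightarrow>
     (\<forall>(n::nat) (u::nat \<Rightarrow> real) h.
        mono_on {0..n} u \<and> 0 \<le> u 0 \<and> 0 \<le> h \<and> u n + h \<le> T \<longrightarrow>
        distr M (PiM {1..n} (\<lambda>_. borel))
          (\<lambda>\<omega>. \<lambda>i\<in>{1..n}. X (u i + h) \<omega> - X (u (i - 1) + h) \<omega>) =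
        distr M (PiM {1..n} (\<lambda>_. borel))
          (\<lambda>\<omega>. \<lambda>i\<in>{1..n}. X (u i) \<omega> - X (u (i - 1)) \<omega>))"

text \<open>
  \<open>X\<close> is an \<open>ML(\<alpha>,b,T)\<close> process on the probability space \<open>M\<close>. Only the values \<open>X r\<close>
  with \<open>0 \<le> r \<le> T\<close> matter. The multiple series of the moment generating function is read as an
  absolutely convergent one, and the expectation on its left-hand side as a finite one.
\<close>

definition mittag_leffler_process ::
    "'a measure \<Rightarrow> real \<Rightarrow> real \<Rightarrow> real \<Rightarrow> (real \<Rightarrow> 'a \<Rightarrow> real) \<Rightarrow> bool" where
  "mittag_leffler_process M \<alpha> b T X \<longleftrightarrow>
     prob_space M \<and>
     (\<forall>r\<in>{0..T}. X r \<in> borel_measurable M) \<and>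
     (AE \<omega> in M. X 0 \<omega> = 0) \<and>
     stationary_increments M T X \<and>
     (\<forall>(m::nat) (t::nat \<Rightarrow> real) (s::nat \<Rightarrow> real).
        1 \<le> m \<and> t 0 = 0 \<and> strict_mono_on {0..m} t \<and> t m \<le> T \<longrightarrow>
        integrable M (\<lambda>\<omega>. exp (\<Sum>j=1..m. s j * X (t j) \<omega>)) \<and>
        (\<forall>C\<in>Pow {1..m} - {{}}. mlp_term \<alpha> m t s C summable_on mlp_exponents (card C)) \<and>
        (LINT \<omega>|M. exp (\<Sum>j=1..m. s j * X (t j) \<omega>)) =
          1 + b * T powr (\<alpha> - 1) / Gamma \<alpha> *
            (\<Sum>C\<in>Pow {1..m} - {{}}. \<Sum>\<^sub>\<infinity>k\<in>mlp_exponents (card C). mlp_term \<alpha> m t s C k))"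

definition nabla :: "real \<Rightarrow> (real \<Rightarrow> 'a \<Rightarrow> real) \<Rightarrow> real \<Rightarrow> 'a \<Rightarrow> real" where
  "nabla d X t = (\<lambda>\<omega>. X t \<omega> - X (t - d) \<omega>)"

definition cov :: "'a measure \<Rightarrow> ('a \<Rightarrow> real) \<Rightarrow> ('a \<Rightarrow> real) \<Rightarrow> real" where
  "cov M Y Z =
     (LINT \<omega>|M. (Y \<omega> - (LINT \<omega>'|M. Y \<omega>')) * (Z \<omega> - (LINT \<omega>'|M. Z \<omega>')))"

definition var :: "'a measure \<Rightarrow> ('a \<Rightarrow> real) \<Rightarrow> real" where
  "var M Y = (LINT \<omega>|M. (Y \<omega> - (LINT \<omega>'|M. Y \<omega>'))\<^sup>2)"

definition corr :: "'a measure \<Rightarrow> ('a \<Rightarrow> real) \<Rightarrow> ('a \<Rightarrow> real) \<Rightarrow> real" where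
  "corr M Y Z = cov M Y Z / sqrt (var M Y * var M Z)"

text \<open>
  The regime \<open>s - t \<rightarrow> 0\<close> over pairs of times with \<open>d \<le> t < s \<le> T\<close> and \<open>0 < s - t < d\<close>;
  neither of the two times is held fixed.
\<close>

definition lag_to_zero :: "real \<Rightarrow> real \<Rightarrow> (real \<times> real) filter" where
  "lag_to_zero d T =
     inf (filtercomap (\<lambda>(t, s). s - t) (nhds 0))
         (principal {(t, s). d \<le> t \<and> t < s \<and> s \<le> T \<and> s - t < d})"

end

theory Submission
  imports Defs "HOL-Real_Asymp.Real_Asymp"
begin

text \<open>
  Write the exponent in the moment generating function in terms of successive increments: with
  \<open>s\<^sub>j = S\<^sub>j - S\<^sub>j\<^sub>+\<^sub>1\<close> it becomes \<open>\<Sum>j. S\<^sub>j Y\<^sub>j\<close> with \<open>Y\<^sub>j = X (t\<^sub>j) - X (t\<^sub>j\<^sub>-\<^sub>1)\<close>, and the coefficients \<open>S\<^sub>j\<close> are free.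
  Moebius inversion over the sets \<open>C\<close> isolates \<open>E (\<Prod>j\<in>C. exp (S\<^sub>j Y\<^sub>j) - 1)\<close> as one power series in
  which all exponents are positive; comparing coefficients gives every mixed moment of increments
  as one integral \<open>mlp_coeff\<close>. For increments over short intervals the factors of the integrand
  linking different intervals are squeezed between constants, and the rest factorizes into the
  one-increment moments; this yields (iii). Parts (i) and (ii) only need the first two moments of
  one increment: by stationarity and polarization,
  \<open>2 E (\<nabla>X\<^sub>t \<nabla>X\<^sub>s) = v (s - t + d) + v \<bar>s - t - d\<bar> - 2 v (s - t)\<close> with \<open>v r = E (X\<^sub>r\<^sup>2)\<close>, a second
  difference of a multiple of \<open>r powr (\<alpha> + 1)\<close>.
\<close>

section \<open>Multivariate power series and moments\<close>

text \<open>In the generating function the set \<open>C\<close> contributes exactly the monomials in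
  the variables \<open>S j\<close> with \<open>j \<in> C\<close>, each to a positive power.
  Different sets share no monomial, so inversion over sets separates their contributions; this is
  why all series here range over exponents at least 1 and why factors \<open>exp u - 1\<close>
  replace \<open>exp u\<close>.

  The obstacle is the linking factor \<open>(x' i - x (i - 1)) powr (\<alpha> - 1)\<close>: it keeps
  the integral from factorizing and is singular where neighbouring cells touch. A single cell has no
  such factor and its integral is exact, which is what makes squares of single increments the right
  currency for (i) and (ii); in (ii) the two increments overlap, so they are not cells of one
  partition at all. For (iii) the partition consists of the points \<open>t i - d\<close> and
  \<open>t i\<close>, and \<open>C\<close> picks every second cell: the skipped cells keep the
  linking distances away from 0 as \<open>d\<close> shrinks.\<close>

lemma powser_eq_0_imp_coeff_0:
  fixes c :: "nat \<Rightarrow> real"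
  assumes "\<And>x. (\<lambda>n. c n * x ^ n) sums 0"
  shows "c n = 0"
  using assms
proof (induction n arbitrary: c)
  case 0
  from 0[of 0] show ?case by simp
next
  case (Suc n)
  have c0: "c 0 = 0" using Suc.prems[of 0] by simp
  have nz: "(\<lambda>n. c (Suc n) * x ^ n) sums 0" if "x \<noteq> 0" for x
  proof -
    have "(\<lambda>n. c (Suc n) * x ^ Suc n) sums 0"
      using Suc.prems[of x] by (subst sums_Suc_iff) (simp add: c0)
    hence "(\<lambda>n. inverse x * (c (Suc n) * x ^ Suc n)) sums (inverse x * 0)"
      by (rule sums_mult)
    thus ?thesis using that by (simp add: field_simps)
  qed
  \<comment> \<open>Having been divided by \<open>x\<close>, the shifted series is known to vanish
    only off 0; continuity of a power series supplies its value at 0.\<close>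
  have "((\<lambda>_. 0) \<longlongrightarrow> c (Suc 0)) (at (0::real))"
    by (rule powser_limit_0_strong[where s = 1]) (use nz in auto)
  hence "c (Suc 0) = 0"
    by (auto dest: LIM_const_eq)
  hence "(\<lambda>n. c (Suc n) * x ^ n) sums 0" for x
    using nz[of x] powser_sums_zero[of "\<lambda>n. c (Suc n)"] by (cases "x = 0") auto
  from Suc.IH[OF this] show ?case .
qed

text \<open>Induction on the variables: summing first over the exponents of the other variables
  leaves a power series in the variable \<open>j\<close> that vanishes identically, so each
  coefficient \<open>c \<theta> n\<close> is 0. These coefficients are again power series, in one
  variable less. As the sums are unordered, splitting off one exponent is a mere reindexing.\<close>

lemma multi_powser_eq_0_imp_coeff_0:
  fixes a :: "('i \<Rightarrow> nat) \<Rightarrow> real"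
  assumes "finite I"
    and "\<And>\<theta>. ((\<lambda>k. a k * (\<Prod>i\<in>I. \<theta> i ^ k i)) has_sum 0) (I \<rightarrow>\<^sub>E {1..})"
    and "k \<in> I \<rightarrow>\<^sub>E {1..}"
  shows "a k = 0"
  using assms
proof (induction I arbitrary: a k rule: finite_induct)
  case empty
  from empty.prems(1)[of "\<lambda>_. 0"] empty.prems(2) show ?case
    by (auto simp: has_sum_finite_iff)
next
  case (insert j I)
  let ?P = "I \<rightarrow>\<^sub>E {1::nat..}"
  define c where "c \<theta> n = (\<Sum>\<^sub>\<infinity>k\<in>?P. a (k(j := n)) * (\<Prod>i\<in>I. \<theta> i ^ k i))" for \<theta> :: "'i \<Rightarrow> real" and n
  have pair: "((\<lambda>(n, k). a (k(j := n)) * (\<Prod>i\<in>I. \<theta> i ^ k i) * x ^ n) has_sum 0) ({1..} \<times> ?P)"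
    for \<theta> :: "'i \<Rightarrow> real" and x
  proof -
    have bij: "bij_betw (\<lambda>(n, k). k(j := n)) ({1..} \<times> ?P) (insert j I \<rightarrow>\<^sub>E {1..})"
      unfolding PiE_insert_eq using insert.hyps(2)
      by (intro bij_betw_imageI inj_combinator) auto
    have "((\<lambda>p. a (case p of (n, k) \<Rightarrow> k(j := n)) * (\<Prod>i\<in>insert j I. (\<theta>(j := x)) i ^ (case p of (n, k) \<Rightarrow> k(j := n)) i))
            has_sum 0) ({1..} \<times> ?P)"
      using insert.prems(1)[of "\<theta>(j := x)"]
      by (subst has_sum_reindex_bij_betw[OF bij])
    moreover have "(\<Prod>i\<in>I. (\<theta>(j := x)) i ^ (k(j := n)) i) = (\<Prod>i\<in>I. \<theta> i ^ k i)" for k n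
      using insert.hyps(2) by (intro prod.cong) auto
    ultimately show ?thesis
      using insert.hyps by (simp add: case_prod_unfold mult_ac)
  qed
  have sm: "(\<lambda>k. a (k(j := n)) * (\<Prod>i\<in>I. \<theta> i ^ k i)) summable_on ?P" if "n \<ge> 1" for \<theta> :: "'i \<Rightarrow> real" and n
  proof -
    \<comment> \<open>At \<open>x = 1\<close> the factor \<open>x ^ n\<close> disappears, and
      summability of the double sum passes to each of its rows.\<close>
    have "(\<lambda>(n, k). a (k(j := n)) * (\<Prod>i\<in>I. \<theta> i ^ k i)) summable_on {1..} \<times> ?P"
      using has_sum_imp_summable[OF pair[of \<theta> 1]] by simp
    from summable_on_SigmaD1[OF this] that show ?thesis by simp
  qed
  have c0: "c \<theta> n = 0" if "n \<ge> 1" for \<theta> n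
  proof -
    \<comment> \<open>The exponent 0 does not occur in the sum; the one-variable result counts from
      0, so the constant term is filled in as 0.\<close>
    have "(\<lambda>m. (if m = 0 then 0 else c \<theta> m) * x ^ m) sums 0" for x
    proof (rule sums_Suc_imp)
      have "((\<lambda>n. c \<theta> n * x ^ n) has_sum 0) {1..}"
      proof (rule has_sum_SigmaD[OF pair[of \<theta> x]], unfold prod.case)
        fix n :: nat assume "n \<in> {1..}"
        thus "((\<lambda>k. a (k(j := n)) * (\<Prod>i\<in>I. \<theta> i ^ k i) * x ^ n) has_sum c \<theta> n * x ^ n) ?P"
          unfolding c_def by (intro has_sum_cmult_left has_sum_infsum sm) simp
      qed
      moreover have "bij_betw Suc UNIV {1..}"
        by (auto simp: bij_betw_def image_iff Suc_le_eq gr0_conv_Suc)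
      ultimately have "((\<lambda>n. c \<theta> (Suc n) * x ^ Suc n) has_sum 0) UNIV"
        by (subst has_sum_reindex_bij_betw[where g = Suc and B = "{1..}"])
      thus "(\<lambda>n. (if Suc n = 0 then 0 else c \<theta> (Suc n)) * x ^ Suc n) sums 0"
        using has_sum_imp_sums by force
    qed simp
    from powser_eq_0_imp_coeff_0[OF this, of n] that show ?thesis by simp
  qed
  have "((\<lambda>k'. a (k'(j := k j)) * (\<Prod>i\<in>I. \<theta> i ^ k' i)) has_sum 0) ?P" for \<theta>
    using has_sum_infsum[OF sm[of "k j" \<theta>]] c0[of "k j" \<theta>] insert.prems(2) by (auto simp: c_def)
  moreover have "restrict k I \<in> ?P"
    using insert.prems(2) by (intro restrict_PiE_iff[THEN iffD2]) auto
  ultimately have "a ((restrict k I)(j := k j)) = 0"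
    by (rule insert.IH)
  moreover have "(restrict k I)(j := k j) = k"
    using insert.prems(2) by (auto simp: PiE_iff extensional_def fun_eq_iff)
  ultimately show ?case by simp
qed

text \<open>Dominated convergence for unordered sums. The single bound \<open>g\<close> on all
  finite absolute partial sums gives absolute convergence both pointwise and after integration, so
  an arbitrary enumeration of \<open>A\<close> may be used and then forgotten.\<close>

lemma has_sum_integral:
  fixes f :: "'k \<Rightarrow> 'a \<Rightarrow> real"
  assumes "countable A"
    and int: "\<And>k. k \<in> A \<Longrightarrow> integrable M (f k)" and g: "integrable M g"
    and le: "\<And>F \<omega>. finite F \<Longrightarrow> F \<subseteq> A \<Longrightarrow> \<omega> \<in> space M \<Longrightarrow> (\<Sum>k\<in>F. \<bar>f k \<omega>\<bar>) \<le> g \<omega>"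
    and S: "\<And>\<omega>. \<omega> \<in> space M \<Longrightarrow> ((\<lambda>k. f k \<omega>) has_sum S \<omega>) A"
  shows "((\<lambda>k. LINT \<omega>|M. f k \<omega>) has_sum (LINT \<omega>|M. S \<omega>)) A"
proof (cases "finite A")
  case True
  have "(LINT \<omega>|M. S \<omega>) = (LINT \<omega>|M. (\<Sum>k\<in>A. f k \<omega>))"
    using S True by (intro Bochner_Integration.integral_cong) (auto simp: has_sum_finite_iff)
  also have "\<dots> = (\<Sum>k\<in>A. LINT \<omega>|M. f k \<omega>)"
    using int by (rule Bochner_Integration.integral_sum)
  finally show ?thesis using True by (simp add: has_sum_finite_iff)
next
  case False
  define e where "e = from_nat_into A"
  have e: "bij_betw e UNIV A"
    unfolding e_def using assms(1) False by (rule bij_betw_from_nat_into)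
  have eA [simp]: "e n \<in> A" for n using e by (auto simp: bij_betw_def)
  have leN: "(\<Sum>i<n. \<bar>f (e i) \<omega>\<bar>) \<le> g \<omega>" if "\<omega> \<in> space M" for n \<omega>
  proof -
    have "(\<Sum>i<n. \<bar>f (e i) \<omega>\<bar>) = (\<Sum>k\<in>e ` {..<n}. \<bar>f k \<omega>\<bar>)"
      using e by (subst sum.reindex) (auto simp: bij_betw_def inj_on_def)
    also have "\<dots> \<le> g \<omega>" using that by (intro le) auto
    finally show ?thesis .
  qed
  have sm: "summable (\<lambda>i. LINT \<omega>|M. norm (f (e i) \<omega>))"
  proof (rule bounded_imp_summable)
    show "(\<Sum>i\<le>n. LINT \<omega>|M. norm (f (e i) \<omega>)) \<le> (LINT \<omega>|M. g \<omega>)" for n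
    proof -
      have "(\<Sum>i\<le>n. LINT \<omega>|M. norm (f (e i) \<omega>)) = (LINT \<omega>|M. (\<Sum>i<Suc n. \<bar>f (e i) \<omega>\<bar>))"
        by (subst Bochner_Integration.integral_sum) (auto simp: lessThan_Suc_atMost int)
      also have "\<dots> \<le> (LINT \<omega>|M. g \<omega>)"
        by (intro integral_mono g Bochner_Integration.integrable_sum integrable_abs int eA leN)
      finally show ?thesis .
    qed
  qed auto
  have "(\<lambda>i. LINT \<omega>|M. f (e i) \<omega>) sums (LINT \<omega>|M. (\<Sum>i. f (e i) \<omega>))"
  proof (rule sums_integral)
    show "AE \<omega> in M. summable (\<lambda>i. norm (f (e i) \<omega>))"
    proof (rule AE_I2)
      fix \<omega> assume "\<omega> \<in> space M"
      thus "summable (\<lambda>i. norm (f (e i) \<omega>))"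
        using leN[of \<omega> "Suc n" for n] by (intro bounded_imp_summable[where B = "g \<omega>"]) (auto simp: lessThan_Suc_atMost)
    qed
  qed (use int sm in auto)
  also have "(LINT \<omega>|M. (\<Sum>i. f (e i) \<omega>)) = (LINT \<omega>|M. S \<omega>)"
  proof (rule Bochner_Integration.integral_cong)
    fix \<omega> assume "\<omega> \<in> space M"
    from S[OF this] have "((\<lambda>i. f (e i) \<omega>) has_sum S \<omega>) UNIV"
      by (subst has_sum_reindex_bij_betw[OF e])
    thus "(\<Sum>i. f (e i) \<omega>) = S \<omega>"
      using has_sum_imp_sums sums_unique by metis
  qed simp
  finally have "(\<lambda>i. LINT \<omega>|M. f (e i) \<omega>) sums (LINT \<omega>|M. S \<omega>)" .
  moreover have "summable (\<lambda>i. norm (LINT \<omega>|M. f (e i) \<omega>))"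
    by (rule summable_comparison_test'[OF sm, of 0]) (auto intro!: integral_abs_bound)
  ultimately have "((\<lambda>i. LINT \<omega>|M. f (e i) \<omega>) has_sum (LINT \<omega>|M. S \<omega>)) UNIV"
    by (intro norm_summable_imp_has_sum) auto
  thus ?thesis by (subst (asm) has_sum_reindex_bij_betw[OF e])
qed

text \<open>Dropping the exponent 0 from each exponential series subtracts 1 from each factor;
  absolute convergence of the factors allows the product of sums to be expanded.\<close>

lemma has_sum_prod_expm1:
  fixes u :: "'i \<Rightarrow> real"
  assumes "finite I"
  shows "((\<lambda>k. \<Prod>i\<in>I. u i ^ k i / fact (k i)) has_sum (\<Prod>i\<in>I. exp (u i) - 1)) (I \<rightarrow>\<^sub>E {1..})"
proof -
  have 1: "((\<lambda>n. u i ^ n / fact n) has_sum (exp (u i) - 1)) {1..}" for i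
  proof -
    have "(\<lambda>n. u i ^ n / fact n) sums exp (u i)"
      using exp_converges[of "u i"] by (simp add: field_simps)
    moreover have "summable (\<lambda>n. norm (u i ^ n / fact n))"
      using summable_norm_exp[of "u i"] by (simp add: field_simps)
    ultimately have "((\<lambda>n. u i ^ n / fact n) has_sum exp (u i)) UNIV"
      by (intro norm_summable_imp_has_sum)
    hence "((\<lambda>n. u i ^ n / fact n) has_sum (exp (u i) - (\<Sum>n\<in>{0}. u i ^ n / fact n))) (UNIV - {0})"
      by (intro has_sum_Diff) (auto simp: has_sum_finite_iff)
    moreover have "UNIV - {0} = {1::nat..}" by auto
    ultimately show ?thesis by simp
  qed
  have "(\<lambda>n. u i ^ n / fact n) summable_on {1..}" for i
    using 1 by (rule has_sum_imp_summable)
  hence abs: "Infinite_Sum.abs_summable_on (\<lambda>n. u i ^ n / fact n) {1..}" for i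
    by (rule summable_on_iff_abs_summable_on_real[THEN iffD1])
  have "Infinite_Sum.abs_summable_on (\<lambda>k. \<Prod>i\<in>I. u i ^ k i / fact (k i)) (I \<rightarrow>\<^sub>E {1..})"
    unfolding abs_summable_equivalent
    using assms abs unfolding abs_summable_equivalent by (intro abs_summable_on_prod_PiE) auto
  hence "(\<lambda>k. \<Prod>i\<in>I. u i ^ k i / fact (k i)) summable_on (I \<rightarrow>\<^sub>E {1..})"
    by (rule summable_on_iff_abs_summable_on_real[THEN iffD2])
  moreover have "infsum (\<lambda>k. \<Prod>i\<in>I. u i ^ k i / fact (k i)) (I \<rightarrow>\<^sub>E {1..}) = (\<Prod>i\<in>I. exp (u i) - 1)"
    using infsum_prod_PiE_abs[OF assms, of "\<lambda>i n. u i ^ n / fact n" "\<lambda>_. {1..}", OF abs]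
    unfolding infsumI[OF 1] .
  ultimately show ?thesis unfolding summable_iff_has_sum_infsum by simp
qed

section \<open>Mixed moments of finitely many variables with a finite moment generating
  function\<close>

context
  fixes M :: "'a measure" and I :: "'i set" and Y :: "'i \<Rightarrow> 'a \<Rightarrow> real"
  assumes fin: "finite I"
    and Y [measurable]: "\<And>i. i \<in> I \<Longrightarrow> Y i \<in> borel_measurable M"
    and mgf: "\<And>\<theta>. integrable M (\<lambda>\<omega>. exp (\<Sum>i\<in>I. \<theta> i * Y i \<omega>))"
begin

text \<open>Each factor satisfies \<open>exp \<bar>x\<bar> \<le> exp x + exp (- x)\<close>;
  expanding the product bounds the function by a sum over all sign patterns \<open>S\<close>, and
  each summand is integrable because the generating function is finite for every sign of the
  arguments.\<close>

lemma integrable_exp_abs: "integrable M (\<lambda>\<omega>. exp (\<Sum>i\<in>I. \<bar>\<theta> i * Y i \<omega>\<bar>))"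
proof (rule Bochner_Integration.integrable_bound)
  let ?s = "\<lambda>S i. if i \<in> S then \<theta> i else - \<theta> i"
  show "integrable M (\<lambda>\<omega>. \<Sum>S\<in>Pow I. exp (\<Sum>i\<in>I. ?s S i * Y i \<omega>))"
    by (intro Bochner_Integration.integrable_sum mgf)
  have "exp (\<Sum>i\<in>I. \<bar>\<theta> i * Y i \<omega>\<bar>) \<le> (\<Sum>S\<in>Pow I. exp (\<Sum>i\<in>I. ?s S i * Y i \<omega>))" for \<omega>
  proof -
    have "exp (\<Sum>i\<in>I. \<bar>\<theta> i * Y i \<omega>\<bar>) = (\<Prod>i\<in>I. exp \<bar>\<theta> i * Y i \<omega>\<bar>)"
      using fin by (rule exp_sum)
    also have "\<dots> \<le> (\<Prod>i\<in>I. exp (\<theta> i * Y i \<omega>) + exp (- \<theta> i * Y i \<omega>))"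
      by (intro prod_mono) (auto simp: abs_if)
    also have "\<dots> = (\<Sum>S\<in>Pow I. (\<Prod>i\<in>S. exp (\<theta> i * Y i \<omega>)) * (\<Prod>i\<in>I - S. exp (- \<theta> i * Y i \<omega>)))"
      using fin by (rule prod_add)
    also have "\<dots> = (\<Sum>S\<in>Pow I. exp (\<Sum>i\<in>I. ?s S i * Y i \<omega>))"
    proof (rule sum.cong)
      fix S assume "S \<in> Pow I"
      hence S: "S \<subseteq> I" by simp
      have "exp (\<Sum>i\<in>I. ?s S i * Y i \<omega>) = (\<Prod>i\<in>S. exp (?s S i * Y i \<omega>)) * (\<Prod>i\<in>I - S. exp (?s S i * Y i \<omega>))"
        using prod.subset_diff[OF S fin, of "\<lambda>i. exp (?s S i * Y i \<omega>)"] fin by (simp add: exp_sum mult.commute)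
      also have "(\<Prod>i\<in>S. exp (?s S i * Y i \<omega>)) = (\<Prod>i\<in>S. exp (\<theta> i * Y i \<omega>))"
        by (intro prod.cong) auto
      also have "(\<Prod>i\<in>I - S. exp (?s S i * Y i \<omega>)) = (\<Prod>i\<in>I - S. exp (- \<theta> i * Y i \<omega>))"
        by (intro prod.cong) auto
      finally show "(\<Prod>i\<in>S. exp (\<theta> i * Y i \<omega>)) * (\<Prod>i\<in>I - S. exp (- \<theta> i * Y i \<omega>)) = exp (\<Sum>i\<in>I. ?s S i * Y i \<omega>)"
        by simp
    qed simp
    finally show ?thesis .
  qed
  thus "AE \<omega> in M. norm (exp (\<Sum>i\<in>I. \<bar>\<theta> i * Y i \<omega>\<bar>)) \<le> norm (\<Sum>S\<in>Pow I. exp (\<Sum>i\<in>I. ?s S i * Y i \<omega>))"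
    by (auto intro!: AE_I2 order_trans[OF _ abs_ge_self])
qed measurable

lemma integrable_monomial: "integrable M (\<lambda>\<omega>. \<Prod>i\<in>I. Y i \<omega> ^ k i)"
proof (rule Bochner_Integration.integrable_bound)
  show "integrable M (\<lambda>\<omega>. (\<Prod>i\<in>I. fact (k i)) * exp (\<Sum>i\<in>I. \<bar>1 * Y i \<omega>\<bar>))"
    by (intro integrable_mult_right integrable_exp_abs)
  have le: "\<bar>x\<bar> ^ n \<le> fact n * exp \<bar>x\<bar>" for x :: real and n
  proof -
    have "(\<lambda>n. \<bar>x\<bar> ^ n / fact n) sums exp \<bar>x\<bar>"
      using exp_converges[of "\<bar>x\<bar>"] by (simp add: field_simps)
    from sum_le_suminf[OF sums_summable[OF this], of "{n}"] sums_unique[OF this]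
    show ?thesis by (simp add: field_simps)
  qed
  have "\<bar>\<Prod>i\<in>I. Y i \<omega> ^ k i\<bar> \<le> (\<Prod>i\<in>I. fact (k i)) * exp (\<Sum>i\<in>I. \<bar>1 * Y i \<omega>\<bar>)" for \<omega>
  proof -
    have "\<bar>\<Prod>i\<in>I. Y i \<omega> ^ k i\<bar> = (\<Prod>i\<in>I. \<bar>Y i \<omega>\<bar> ^ k i)" by (simp add: abs_prod power_abs)
    also have "\<dots> \<le> (\<Prod>i\<in>I. fact (k i) * exp \<bar>Y i \<omega>\<bar>)" by (intro prod_mono) (auto intro: le)
    also have "\<dots> = (\<Prod>i\<in>I. fact (k i)) * exp (\<Sum>i\<in>I. \<bar>1 * Y i \<omega>\<bar>)"
      using fin by (simp add: prod.distrib exp_sum)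
    finally show ?thesis .
  qed
  thus "AE \<omega> in M. norm (\<Prod>i\<in>I. Y i \<omega> ^ k i) \<le> norm ((\<Prod>i\<in>I. fact (k i)) * exp (\<Sum>i\<in>I. \<bar>1 * Y i \<omega>\<bar>))"
    by (auto simp: abs_mult abs_prod)
qed measurable

text \<open>Termwise integration of \<open>has_sum_prod_expm1\<close>; the same expansion at the
  absolute values dominates all finite partial sums by the integrable function of
  \<open>integrable_exp_abs\<close>.\<close>

lemma has_sum_moments:
  "((\<lambda>k. (LINT \<omega>|M. (\<Prod>i\<in>I. Y i \<omega> ^ k i)) / (\<Prod>i\<in>I. fact (k i)) * (\<Prod>i\<in>I. \<theta> i ^ k i))
     has_sum (LINT \<omega>|M. (\<Prod>i\<in>I. exp (\<theta> i * Y i \<omega>) - 1))) (I \<rightarrow>\<^sub>E {1..})"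
proof -
  let ?f = "\<lambda>k \<omega>. \<Prod>i\<in>I. (\<theta> i * Y i \<omega>) ^ k i / fact (k i)"
  have eq: "?f k = (\<lambda>\<omega>. (\<Prod>i\<in>I. Y i \<omega> ^ k i) * ((\<Prod>i\<in>I. \<theta> i ^ k i) / (\<Prod>i\<in>I. fact (k i))))" for k
    by (simp add: prod.distrib prod_dividef power_mult_distrib mult_ac fun_eq_iff)
  have "((\<lambda>k. LINT \<omega>|M. ?f k \<omega>) has_sum (LINT \<omega>|M. (\<Prod>i\<in>I. exp (\<theta> i * Y i \<omega>) - 1))) (I \<rightarrow>\<^sub>E {1..})"
  proof (rule has_sum_integral)
    show "countable (I \<rightarrow>\<^sub>E {1::nat..})" using fin by (intro countable_PiE) auto
    show "integrable M (?f k)" for k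
      unfolding eq by (intro integrable_mult_left integrable_monomial)
    show "integrable M (\<lambda>\<omega>. exp (\<Sum>i\<in>I. \<bar>\<theta> i * Y i \<omega>\<bar>))" by (rule integrable_exp_abs)
    show "((\<lambda>k. ?f k \<omega>) has_sum (\<Prod>i\<in>I. exp (\<theta> i * Y i \<omega>) - 1)) (I \<rightarrow>\<^sub>E {1..})" for \<omega>
      using fin by (rule has_sum_prod_expm1)
    fix F \<omega> assume F: "finite F" "F \<subseteq> I \<rightarrow>\<^sub>E {1::nat..}"
    have "(\<Sum>k\<in>F. \<bar>?f k \<omega>\<bar>) = (\<Sum>k\<in>F. \<Prod>i\<in>I. \<bar>\<theta> i * Y i \<omega>\<bar> ^ k i / fact (k i))"
      by (simp add: abs_prod power_abs)
    also have "\<dots> \<le> (\<Prod>i\<in>I. exp \<bar>\<theta> i * Y i \<omega>\<bar> - 1)"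
      using has_sum_prod_expm1[OF fin] F
      by (rule finite_sum_le_has_sum) (auto intro!: prod_nonneg)
    also have "\<dots> \<le> exp (\<Sum>i\<in>I. \<bar>\<theta> i * Y i \<omega>\<bar>)"
      unfolding exp_sum[OF fin] by (intro prod_mono) auto
    finally show "(\<Sum>k\<in>F. \<bar>?f k \<omega>\<bar>) \<le> exp (\<Sum>i\<in>I. \<bar>\<theta> i * Y i \<omega>\<bar>)" .
  qed
  thus ?thesis unfolding eq by (simp add: mult_ac)
qed

end

section \<open>Mixed moments of increments\<close>

lemma bij_betw_nth_elem:
  assumes "finite C"
  shows "bij_betw (nth_elem C) {1..card C} C"
proof -
  have "bij_betw ((!) (sorted_list_of_set C)) {..<length (sorted_list_of_set C)} (set (sorted_list_of_set C))"
    by (rule bij_betw_nth) auto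
  moreover have "bij_betw (\<lambda>i. i - 1) {1..card C} {..<card C}"
    by (rule bij_betw_byWitness[where f' = Suc]) auto
  ultimately show ?thesis
    using assms bij_betw_trans[of "\<lambda>i. i - 1" "{1..card C}" "{..<card C}" "(!) (sorted_list_of_set C)" C]
    by (simp add: nth_elem_def[abs_def] comp_def)
qed

lemma nth_elem_in: "finite C \<Longrightarrow> i \<in> {1..card C} \<Longrightarrow> nth_elem C i \<in> C"
  using bij_betw_nth_elem bij_betwE by blast

lemma sum_by_parts:
  fixes S x :: "nat \<Rightarrow> real"
  shows "(\<Sum>j=1..n. (S j - S (Suc j)) * x j) = (\<Sum>j=1..n. S j * (x j - x (j - 1))) - S (Suc n) * x n + S 1 * x 0"
  by (induction n) (simp_all add: algebra_simps)

locale mittag_leffler =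
  fixes M :: "'a measure" and \<alpha> b T :: real and X :: "real \<Rightarrow> 'a \<Rightarrow> real"
  assumes \<alpha>: "0 < \<alpha>" "\<alpha> < 1" and b: "0 < b" "b \<le> 1" and T: "0 < T"
    and process: "mittag_leffler_process M \<alpha> b T X"
begin

sublocale prob_space M
  using process by (simp add: mittag_leffler_process_def)

text \<open>The factor in front of the series; it turns out to be the mean of an increment per unit
  of time.\<close>

definition rate :: real where "rate = b * T powr (\<alpha> - 1) / Gamma \<alpha>"

lemma X_measurable: "0 \<le> r \<Longrightarrow> r \<le> T \<Longrightarrow> X r \<in> borel_measurable M"
  using process by (simp add: mittag_leffler_process_def)

lemma AE_X_0: "AE \<omega> in M. X 0 \<omega> = 0"
  using process by (simp add: mittag_leffler_process_def)

context
  fixes n :: nat and t :: "nat \<Rightarrow> real"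
  assumes n: "1 \<le> n" and t: "t 0 = 0" "strict_mono_on {0..n} t" "t n \<le> T"
begin

lemma times_bounds: "j \<le> n \<Longrightarrow> 0 \<le> t j \<and> t j \<le> T"
  using strict_mono_on_leD[OF t(2), of 0 j] strict_mono_on_leD[OF t(2), of j n] t by auto

lemma increment_measurable: "j \<in> {1..n} \<Longrightarrow> (\<lambda>\<omega>. X (t j) \<omega> - X (t (j - 1)) \<omega>) \<in> borel_measurable M"
  using times_bounds by (intro borel_measurable_diff X_measurable) auto

text \<open>This is \<open>mlp_term\<close> with the tail sums of \<open>s\<close> replaced by a
  freely chosen \<open>S\<close>.\<close>

definition mgf_series :: "nat set \<Rightarrow> (nat \<Rightarrow> real) \<Rightarrow> (nat \<Rightarrow> nat) \<Rightarrow> real" where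
  "mgf_series C S k = t (nth_elem C (card C)) powr (\<alpha> * ((\<Sum>i=1..card C. real (k i)) - 1) + 1) *
  (\<Prod>i=1..card C. S (nth_elem C i) ^ k i) * mlp_coeff \<alpha> t C k"

lemma mgf_increments:
  fixes S :: "nat \<Rightarrow> real"
  shows "integrable M (\<lambda>\<omega>. exp (\<Sum>j=1..n. S j * (X (t j) \<omega> - X (t (j - 1)) \<omega>)))" (is ?A)
    and "C \<subseteq> {1..n} \<Longrightarrow> C \<noteq> {} \<Longrightarrow> mgf_series C S summable_on mlp_exponents (card C)"
    and "(LINT \<omega>|M. exp (\<Sum>j=1..n. S j * (X (t j) \<omega> - X (t (j - 1)) \<omega>))) =
      1 + (\<Sum>C\<in>Pow {1..n} - {{}}. rate * (\<Sum>\<^sub>\<infinity>k\<in>mlp_exponents (card C). mgf_series C S k))" (is ?B)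
proof -
  \<comment> \<open>Cutting \<open>S\<close> off after \<open>n\<close> removes the boundary term of
    the summation by parts and gives \<open>s n = S n\<close>.\<close>
  define S' where "S' j = (if j \<le> n then S j else 0)" for j
  define s where "s j = S' j - S' (Suc j)" for j
  have tail: "(\<Sum>j=i..n. s j) = S i" if "i \<in> {1..n}" for i
  proof -
    have "(\<Sum>j=i..<Suc n. S' (Suc j) - S' j) = S' (Suc n) - S' i"
      using that by (intro sum_Suc_diff') auto
    hence "- (\<Sum>j=i..n. S' (Suc j) - S' j) = S i"
      using that by (simp add: S'_def atLeastLessThanSuc_atLeastAtMost)
    thus ?thesis by (simp add: s_def sum_subtractf)
  qed
  have eqt: "mlp_term \<alpha> n t s C k = mgf_series C S k" if "C \<subseteq> {1..n}" for C k
  proof -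
    have "nth_elem C i \<in> {1..n}" if "i \<in> {1..card C}" for i
      using nth_elem_in[OF _ that] \<open>C \<subseteq> {1..n}\<close> finite_subset by blast
    hence "(\<Prod>i=1..card C. (\<Sum>j=nth_elem C i..n. s j) ^ k i) = (\<Prod>i=1..card C. S (nth_elem C i) ^ k i)"
      by (intro prod.cong) (auto simp: tail)
    thus ?thesis unfolding mlp_term_def mgf_series_def by simp
  qed
  note * = process[unfolded mittag_leffler_process_def, THEN conjunct2, THEN conjunct2, THEN conjunct2,
      THEN conjunct2, THEN spec[of _ n], THEN spec[of _ t], THEN spec[of _ s], THEN mp,
      OF conjI[OF n conjI[OF t(1) conjI[OF t(2,3)]]]]
  \<comment> \<open>The two exponents agree only almost surely, because \<open>X 0\<close> vanishes
    only almost surely.\<close>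
  have AE_eq: "AE \<omega> in M. (\<Sum>j=1..n. s j * X (t j) \<omega>) = (\<Sum>j=1..n. S j * (X (t j) \<omega> - X (t (j - 1)) \<omega>))"
    using AE_X_0
  proof eventually_elim
    case (elim \<omega>)
    have "(\<Sum>j=1..n. s j * X (t j) \<omega>) = (\<Sum>j=1..n. S' j * (X (t j) \<omega> - X (t (j - 1)) \<omega>))"
      unfolding s_def using elim t(1) by (subst sum_by_parts) (simp add: S'_def)
    thus ?case by (simp add: S'_def)
  qed
  have meas: "(\<lambda>\<omega>. exp (\<Sum>j=1..n. S j * (X (t j) \<omega> - X (t (j - 1)) \<omega>))) \<in> borel_measurable M"
    by (intro borel_measurable_exp[THEN measurable_compose[rotated]] borel_measurable_sum borel_measurable_times
        increment_measurable) auto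
  have meas': "(\<lambda>\<omega>. exp (\<Sum>j=1..n. s j * X (t j) \<omega>)) \<in> borel_measurable M"
    using * by (auto dest: borel_measurable_integrable)
  show ?A
    by (rule iffD1[OF integrable_cong_AE[OF meas' meas]]) (use * AE_eq in auto)
  show "mgf_series C S summable_on mlp_exponents (card C)" if "C \<subseteq> {1..n}" "C \<noteq> {}"
  proof -
    have "mlp_term \<alpha> n t s C = mgf_series C S" using eqt[OF that(1)] by (rule ext)
    moreover have "C \<in> Pow {1..n} - {{}}" using that by simp
    ultimately show ?thesis using * by metis
  qed
  have "(LINT \<omega>|M. exp (\<Sum>j=1..n. S j * (X (t j) \<omega> - X (t (j - 1)) \<omega>))) = (LINT \<omega>|M. exp (\<Sum>j=1..n. s j * X (t j) \<omega>))"
    using AE_eq by (intro integral_cong_AE meas meas') auto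
  also have "\<dots> = 1 + rate * (\<Sum>C\<in>Pow {1..n} - {{}}. \<Sum>\<^sub>\<infinity>k\<in>mlp_exponents (card C). mlp_term \<alpha> n t s C k)"
    using * by (simp add: rate_def)
  also have "(\<Sum>C\<in>Pow {1..n} - {{}}. \<Sum>\<^sub>\<infinity>k\<in>mlp_exponents (card C). mlp_term \<alpha> n t s C k) =
      (\<Sum>C\<in>Pow {1..n} - {{}}. \<Sum>\<^sub>\<infinity>k\<in>mlp_exponents (card C). mgf_series C S k)"
    by (intro sum.cong refl infsum_cong eqt) auto
  finally show ?B by (simp add: sum_distrib_left)
qed

text \<open>All exponents are at least 1, so one vanishing \<open>S j\<close> with
  \<open>j \<in> C\<close> kills every term of the series of \<open>C\<close>. Setting
  \<open>S\<close> to 0 outside \<open>D\<close> therefore keeps exactly the sets \<open>C\<close>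
  inside \<open>D\<close>.\<close>

lemma mgf_series_restrict:
  assumes "finite C"
  shows "(\<Sum>\<^sub>\<infinity>k\<in>mlp_exponents (card C). mgf_series C (\<lambda>j. if j \<in> D then S j else 0) k) =
    (if C \<subseteq> D then \<Sum>\<^sub>\<infinity>k\<in>mlp_exponents (card C). mgf_series C S k else 0)"
proof (cases "C \<subseteq> D")
  case True
  have "(\<Prod>i=1..card C. (if nth_elem C i \<in> D then S (nth_elem C i) else 0) ^ k i) =
      (\<Prod>i=1..card C. S (nth_elem C i) ^ k i)" for k
    using nth_elem_in[OF assms] True by (intro prod.cong) auto
  hence "mgf_series C (\<lambda>j. if j \<in> D then S j else 0) k = mgf_series C S k" for k
    unfolding mgf_series_def by simp
  with True show ?thesis by simp
next
  case False
  then obtain j where "j \<in> C" "j \<notin> D" by auto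
  then obtain i where i: "i \<in> {1..card C}" "nth_elem C i \<notin> D"
    using bij_betw_nth_elem[OF assms] unfolding bij_betw_def by (metis imageE)
  have "mgf_series C (\<lambda>j. if j \<in> D then S j else 0) k = 0" if "k \<in> mlp_exponents (card C)" for k
  proof -
    have "k i > 0" using i(1) that by (auto simp: PiE_iff Suc_le_eq)
    hence "(\<Prod>i=1..card C. (if nth_elem C i \<in> D then S (nth_elem C i) else 0) ^ k i) = 0"
      using i by (intro prod_zero) (auto intro!: bexI[of _ i])
    thus ?thesis unfolding mgf_series_def by simp
  qed
  with False show ?thesis by (simp only: infsum_0 if_False)
qed

text \<open>The generating function with \<open>S\<close> set to 0 outside \<open>D\<close> is the
  sum of the contributions of all subsets of \<open>D\<close>. Moebius inversion writes the
  contribution of \<open>C\<close> as an alternating sum of these functions over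
  \<open>D \<subseteq> C\<close>, and the same alternating sum arises from multiplying out the
  product of the factors \<open>exp u - 1\<close>.\<close>

lemma expectation_prod_expm1_increments:
  assumes "C \<subseteq> {1..n}" "C \<noteq> {}"
  shows "(LINT \<omega>|M. (\<Prod>j\<in>C. exp (S j * (X (t j) \<omega> - X (t (j - 1)) \<omega>)) - 1)) =
    rate * (\<Sum>\<^sub>\<infinity>k\<in>mlp_exponents (card C). mgf_series C S k)"
proof -
  let ?Y = "\<lambda>j \<omega>. X (t j) \<omega> - X (t (j - 1)) \<omega>"
  let ?S = "\<lambda>D j. if j \<in> D then S j else 0"
  let ?H = "\<lambda>D. LINT \<omega>|M. exp (\<Sum>j=1..n. ?S D j * ?Y j \<omega>)"
  define G where "G C = (\<Sum>\<^sub>\<infinity>k\<in>mlp_exponents (card C). mgf_series C S k)" for C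
  \<comment> \<open>The empty set carries the constant term 1 of the generating function.\<close>
  define f where "f C = (if C = {} then 1 else if C \<subseteq> {1..n} then rate * G C else 0)" for C
  have finC: "finite C" using assms finite_subset by blast
  have H: "?H D = sum f (Pow D)" if "D \<subseteq> {1..n}" for D
  proof -
    have finD: "finite D" using that finite_subset by blast
    have "?H D = 1 + (\<Sum>C\<in>Pow {1..n} - {{}}. if C \<subseteq> D then rate * G C else 0)"
      unfolding mgf_increments(3)[of "?S D"]
      by (intro arg_cong2[where f = "(+)"] sum.cong refl)
        (subst mgf_series_restrict, auto simp: G_def intro: finite_subset)
    also have "(\<Sum>C\<in>Pow {1..n} - {{}}. if C \<subseteq> D then rate * G C else 0) = (\<Sum>C\<in>Pow D - {{}}. f C)"
      using that by (intro sum.mono_neutral_cong_right) (auto simp: f_def)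
    also have "1 + \<dots> = sum f (Pow D)"
      using finD by (subst sum.remove[of _ "{}"]) (auto simp: f_def)
    finally show ?thesis .
  qed
  have "rate * G C = f C" using assms by (simp add: f_def)
  also have "\<dots> = (\<Sum>D\<in>Pow C. (-1) ^ (card C - card D) * sum f (Pow D))"
    by (rule inclusion_exclusion_mobius[OF refl finC])
  also have "\<dots> = (\<Sum>D\<in>Pow C. (-1) ^ (card C - card D) * ?H D)"
    using assms H by (intro sum.cong) auto
  also have "\<dots> = (LINT \<omega>|M. (\<Sum>D\<in>Pow C. (-1) ^ (card C - card D) * exp (\<Sum>j=1..n. ?S D j * ?Y j \<omega>)))"
    by (subst Bochner_Integration.integral_sum) (intro integrable_mult_right mgf_increments(1), simp)
  also have "\<dots> = (LINT \<omega>|M. (\<Prod>j\<in>C. exp (S j * ?Y j \<omega>) + (-1)))"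
  proof (rule Bochner_Integration.integral_cong[OF refl])
    fix \<omega>
    show "(\<Sum>D\<in>Pow C. (-1) ^ (card C - card D) * exp (\<Sum>j=1..n. ?S D j * ?Y j \<omega>)) = (\<Prod>j\<in>C. exp (S j * ?Y j \<omega>) + (-1))"
      unfolding prod_add[OF finC]
    proof (rule sum.cong[OF refl])
      fix D assume "D \<in> Pow C"
      hence D: "D \<subseteq> C" "finite D" using finC finite_subset by auto
      have "(\<Sum>j=1..n. ?S D j * ?Y j \<omega>) = (\<Sum>j\<in>D. S j * ?Y j \<omega>)"
        using D assms by (intro sum.mono_neutral_cong_right) auto
      thus "(-1) ^ (card C - card D) * exp (\<Sum>j=1..n. ?S D j * ?Y j \<omega>) = (\<Prod>j\<in>D. exp (S j * ?Y j \<omega>)) * (\<Prod>j\<in>C - D. -1)"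
        using D by (simp add: exp_sum card_Diff_subset mult.commute)
    qed
  qed
  finally show ?thesis by (simp add: G_def)
qed

text \<open>The expectation of the product of the factors
  \<open>exp (\<theta> i * D i \<omega>) - 1\<close> has two expansions in \<open>\<theta>\<close>,
  one through moments and one through \<open>mlp_coeff\<close>; uniqueness of the coefficients
  equates them.\<close>

lemma increment_moments:
  assumes C: "C \<subseteq> {1..n}" "C \<noteq> {}" and k: "k \<in> mlp_exponents (card C)"
  defines "D \<equiv> \<lambda>i \<omega>. X (t (nth_elem C i)) \<omega> - X (t (nth_elem C i - 1)) \<omega>"
  shows "integrable M (\<lambda>\<omega>. \<Prod>i=1..card C. D i \<omega> ^ k i)"
    and "(LINT \<omega>|M. (\<Prod>i=1..card C. D i \<omega> ^ k i)) =
      rate * (\<Prod>i=1..card C. fact (k i)) *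
      t (nth_elem C (card C)) powr (\<alpha> * ((\<Sum>i=1..card C. real (k i)) - 1) + 1) * mlp_coeff \<alpha> t C k"
proof -
  let ?Y = "\<lambda>j \<omega>. X (t j) \<omega> - X (t (j - 1)) \<omega>"
  let ?p = "\<lambda>k. t (nth_elem C (card C)) powr (\<alpha> * ((\<Sum>i=1..card C. real (k i)) - 1) + 1)"
  have finC: "finite C" using C finite_subset by blast
  note bij = bij_betw_nth_elem[OF finC]
  note inC = nth_elem_in[OF finC]
  \<comment> \<open>Exponents and variables are indexed by positions in \<open>C\<close>, the
    increments by elements of \<open>C\<close>; \<open>S\<close> carries a variable from a position
    to the element there.\<close>
  define S where "S \<theta> j = \<theta> (inv_into {1..card C} (nth_elem C) j)" for \<theta> :: "nat \<Rightarrow> real" and j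
  have S: "S \<theta> (nth_elem C i) = \<theta> i" if "i \<in> {1..card C}" for \<theta> i
    unfolding S_def using bij that by (simp add: bij_betw_def)
  have meas: "D i \<in> borel_measurable M" if "i \<in> {1..card C}" for i
    unfolding D_def using inC[OF that] C by (intro increment_measurable) auto
  have mgf: "integrable M (\<lambda>\<omega>. exp (\<Sum>i=1..card C. \<theta> i * D i \<omega>))" for \<theta>
  proof -
    have "(\<Sum>j=1..n. (if j \<in> C then S \<theta> j else 0) * ?Y j \<omega>) = (\<Sum>i=1..card C. \<theta> i * D i \<omega>)" for \<omega>
    proof -
      have "(\<Sum>j=1..n. (if j \<in> C then S \<theta> j else 0) * ?Y j \<omega>) = (\<Sum>j\<in>C. S \<theta> j * ?Y j \<omega>)"
        using C by (intro sum.mono_neutral_cong_right) auto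
      also have "\<dots> = (\<Sum>i=1..card C. S \<theta> (nth_elem C i) * ?Y (nth_elem C i) \<omega>)"
        by (rule sum.reindex_bij_betw[OF bij, symmetric])
      finally show ?thesis by (simp add: S D_def)
    qed
    with mgf_increments(1)[of "\<lambda>j. if j \<in> C then S \<theta> j else 0"] show ?thesis by simp
  qed
  show "integrable M (\<lambda>\<omega>. \<Prod>i=1..card C. D i \<omega> ^ k i)"
    by (rule integrable_monomial[OF _ meas mgf]) auto
  let ?E = "\<lambda>k. LINT \<omega>|M. (\<Prod>i=1..card C. D i \<omega> ^ k i)"
  have "?E k / (\<Prod>i=1..card C. fact (k i)) - rate * ?p k * mlp_coeff \<alpha> t C k = 0"
  proof (rule multi_powser_eq_0_imp_coeff_0[where I = "{1..card C}", OF _ _ k])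
    fix \<theta> :: "nat \<Rightarrow> real"
    let ?U = "LINT \<omega>|M. (\<Prod>i=1..card C. exp (\<theta> i * D i \<omega>) - 1)"
    have 1: "((\<lambda>k. ?E k / (\<Prod>i=1..card C. fact (k i)) * (\<Prod>i=1..card C. \<theta> i ^ k i)) has_sum ?U) (mlp_exponents (card C))"
      by (rule has_sum_moments[OF _ meas mgf]) auto
    have "(\<Prod>j\<in>C. exp (S \<theta> j * ?Y j \<omega>) - 1) = (\<Prod>i=1..card C. exp (\<theta> i * D i \<omega>) - 1)" for \<omega>
      using prod.reindex_bij_betw[OF bij, of "\<lambda>j. exp (S \<theta> j * ?Y j \<omega>) - 1"] by (simp add: S D_def)
    hence U: "?U = rate * (\<Sum>\<^sub>\<infinity>k\<in>mlp_exponents (card C). mgf_series C (S \<theta>) k)"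
      using expectation_prod_expm1_increments[OF C, of "S \<theta>"] by simp
    have "((\<lambda>k. rate * mgf_series C (S \<theta>) k) has_sum ?U) (mlp_exponents (card C))"
      unfolding U by (intro has_sum_cmult_right has_sum_infsum mgf_increments(2) C)
    moreover have "mgf_series C (S \<theta>) k = ?p k * (\<Prod>i=1..card C. \<theta> i ^ k i) * mlp_coeff \<alpha> t C k" for k
      unfolding mgf_series_def by (simp add: S)
    ultimately have 2: "((\<lambda>k. rate * ?p k * mlp_coeff \<alpha> t C k * (\<Prod>i=1..card C. \<theta> i ^ k i)) has_sum ?U) (mlp_exponents (card C))"
      by (simp add: mult_ac)
    from has_sum_add[OF 1 has_sum_uminusI[OF 2]]
    show "((\<lambda>k. (?E k / (\<Prod>i=1..card C. fact (k i)) - rate * ?p k * mlp_coeff \<alpha> t C k) * (\<Prod>i=1..card C. \<theta> i ^ k i))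
        has_sum 0) (mlp_exponents (card C))"
      by (simp add: left_diff_distrib)
  qed auto
  moreover have "(\<Prod>i=1..card C. fact (k i) :: real) \<noteq> 0" by simp
  ultimately show "?E k = rate * (\<Prod>i=1..card C. fact (k i)) * ?p k * mlp_coeff \<alpha> t C k"
    by (simp add: field_simps)
qed

end

end

section \<open>Bounds on the coefficient integrals\<close>

lemma nn_integral_powr_left:
  fixes a b \<gamma> :: real
  assumes "\<gamma> > -1" "a \<le> b"
  shows "(\<integral>\<^sup>+x. ennreal (if a < x \<and> x < b then (x - a) powr \<gamma> else 0) \<partial>lborel) =
    ennreal ((b - a) powr (\<gamma> + 1) / (\<gamma> + 1))"
proof -
  have "(\<integral>\<^sup>+x. ennreal (if a < x \<and> x < b then (x - a) powr \<gamma> else 0) \<partial>lborel) =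
      (\<integral>\<^sup>+x. ennreal (if 0 < x \<and> x < b - a then x powr \<gamma> else 0) \<partial>lborel)"
    by (subst nn_integral_real_affine[where c = 1 and t = a]) (auto intro!: nn_integral_cong)
  also have "\<dots> = (\<integral>\<^sup>+x. ennreal (indicator {0..b - a} x * x powr \<gamma>) \<partial>lborel)"
    using AE_lborel_singleton[of "b - a"]
    by (intro nn_integral_cong_AE, elim eventually_mono) (auto simp: indicator_def)
  also have "\<dots> = ennreal ((b - a) powr (\<gamma> + 1) / (\<gamma> + 1))"
    using assms by (intro nn_integral_has_integral_lebesgue has_integral_powr_from_0) auto
  finally show ?thesis .
qed

lemma nn_integral_powr_right:
  fixes a b \<gamma> :: real
  assumes "\<gamma> > -1" "a \<le> b"
  shows "(\<integral>\<^sup>+x. ennreal (if a < x \<and> x < b then (b - x) powr \<gamma> else 0) \<partial>lborel) =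
    ennreal ((b - a) powr (\<gamma> + 1) / (\<gamma> + 1))"
proof -
  have "(\<integral>\<^sup>+x. ennreal (if a < x \<and> x < b then (b - x) powr \<gamma> else 0) \<partial>lborel) =
      (\<integral>\<^sup>+x. ennreal (if a < x \<and> x < b then (x - a) powr \<gamma> else 0) \<partial>lborel)"
    by (subst nn_integral_real_affine[where c = "-1" and t = "a + b"]) (auto intro!: nn_integral_cong)
  thus ?thesis using nn_integral_powr_left[OF assms] by simp
qed

text \<open>The part of \<open>mlp_integrand\<close> that involves a single cell
  \<open>(l, u)\<close>, with the indicator of the region built in; \<open>w\<close> and
  \<open>v\<close> stand for \<open>x' i\<close> and \<open>x i\<close>. For \<open>k = 1\<close>
  there is no coordinate \<open>x' i\<close>, and \<open>w\<close> is ignored.\<close>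

definition cell_kernel :: "real \<Rightarrow> nat \<Rightarrow> real \<Rightarrow> real \<Rightarrow> real \<Rightarrow> real \<Rightarrow> real" where
  "cell_kernel \<alpha> k l u w v =
     (if k \<ge> 2
      then if l < w \<and> w < v \<and> v < u
           then (v - w) powr (\<alpha> * (real k - 1) - 1) / Gamma ((real k - 1) * \<alpha>) else 0
      else if l < v \<and> v < u then 1 else 0)"

text \<open>The integral of \<open>cell_kernel\<close> over a cell of length
  \<open>\<delta>\<close>. Up to the factor \<open>rate * fact k\<close> it is the
  \<open>k\<close>-th moment of an increment of that length.\<close>

definition cell_mass :: "real \<Rightarrow> nat \<Rightarrow> real \<Rightarrow> real" where
  "cell_mass \<alpha> k \<delta> = \<delta> powr (\<alpha> * (real k - 1) + 1) / Gamma (\<alpha> * (real k - 1) + 2)"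

lemma cell_kernel_nonneg: "\<alpha> > 0 \<Longrightarrow> 0 \<le> cell_kernel \<alpha> k l u w v"
  by (auto simp: cell_kernel_def intro!: divide_nonneg_pos Gamma_real_pos)

lemma cell_mass_nonneg: "\<alpha> > 0 \<Longrightarrow> k \<ge> 1 \<Longrightarrow> 0 \<le> cell_mass \<alpha> k \<delta>"
  by (auto simp: cell_mass_def intro!: divide_nonneg_pos Gamma_real_pos add_nonneg_pos)

lemma cell_kernel_measurable [measurable]:
  assumes [measurable]: "f \<in> borel_measurable N" "g \<in> borel_measurable N"
  shows "(\<lambda>x. cell_kernel \<alpha> k l u (f x) (g x)) \<in> borel_measurable N"
  unfolding cell_kernel_def by measurable

text \<open>Here \<open>f\<close> is going to be a coordinate \<open>x' i\<close> whose index is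
  missing from the first product space, so nothing is asked of it.\<close>

lemma cell_kernel_measurable_not_ge_2:
  assumes "\<not> k \<ge> 2" and [measurable]: "g \<in> borel_measurable N"
  shows "(\<lambda>x. cell_kernel \<alpha> k l u (f x) (g x)) \<in> borel_measurable N"
  unfolding cell_kernel_def using assms(1) by simp

lemma nn_integral_cell_kernel_1:
  assumes "\<not> k \<ge> 2" "k \<ge> 1" "l \<le> u"
  shows "(\<integral>\<^sup>+v. ennreal (cell_kernel \<alpha> k l u w v) \<partial>lborel) = ennreal (cell_mass \<alpha> k (u - l))"
proof -
  have "k = 1" using assms by linarith
  have "(\<integral>\<^sup>+v. ennreal (cell_kernel \<alpha> k l u w v) \<partial>lborel) = (\<integral>\<^sup>+v. indicator {l<..<u} v \<partial>lborel)"
    using \<open>k = 1\<close> by (intro nn_integral_cong) (auto simp: cell_kernel_def indicator_def)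
  also have "\<dots> = ennreal (cell_mass \<alpha> k (u - l))"
    unfolding cell_mass_def \<open>k = 1\<close> using assms(3) Gamma_fact[of 1, where 'a = real] by simp
  finally show ?thesis .
qed

text \<open>With \<open>\<beta> = \<alpha> * (real k - 1) > 0\<close> the singularity at
  \<open>v = w\<close> is integrable. Both integrations raise the exponent by one, and the
  functional equation absorbs the new denominators, leading from \<open>Gamma \<beta>\<close> to
  \<open>Gamma (\<beta> + 2)\<close>.\<close>

lemma nn_integral_cell_kernel_2:
  assumes "k \<ge> 2" "l \<le> u" "\<alpha> > 0"
  shows "(\<integral>\<^sup>+w. \<integral>\<^sup>+v. ennreal (cell_kernel \<alpha> k l u w v) \<partial>lborel \<partial>lborel) = ennreal (cell_mass \<alpha> k (u - l))"
proof -
  define \<beta> where "\<beta> = \<alpha> * (real k - 1)"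
  have \<beta>: "\<beta> > 0" using assms by (simp add: \<beta>_def)
  have G0: "Gamma \<beta> > 0" "Gamma (\<beta> + 1) > 0" using \<beta> by (auto intro: Gamma_real_pos)
  have nz: "\<beta> \<notin> \<int>\<^sub>\<le>\<^sub>0" "\<beta> + 1 \<notin> \<int>\<^sub>\<le>\<^sub>0" using \<beta> by (auto elim!: nonpos_Ints_cases)
  have G1: "Gamma (\<beta> + 1) = \<beta> * Gamma \<beta>" using Gamma_plus1[OF nz(1)] .
  have G2: "Gamma (\<beta> + 2) = (\<beta> + 1) * Gamma (\<beta> + 1)" using Gamma_plus1[OF nz(2)] by (simp add: add.assoc)
  have "(\<integral>\<^sup>+v. ennreal (cell_kernel \<alpha> k l u w v) \<partial>lborel) =
      ennreal (1 / Gamma (\<beta> + 1)) * ennreal (if l < w \<and> w < u then (u - w) powr \<beta> else 0)" for w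
  proof (cases "l < w \<and> w < u")
    case True
    have "(\<integral>\<^sup>+v. ennreal (cell_kernel \<alpha> k l u w v) \<partial>lborel) =
        (\<integral>\<^sup>+v. ennreal (1 / Gamma \<beta>) * ennreal (if w < v \<and> v < u then (v - w) powr (\<beta> - 1) else 0) \<partial>lborel)"
      using assms(1) True G0
      by (intro nn_integral_cong) (auto simp: cell_kernel_def \<beta>_def mult.commute simp flip: ennreal_mult'')
    also have "\<dots> = ennreal (1 / Gamma \<beta>) * ennreal ((u - w) powr (\<beta> - 1 + 1) / (\<beta> - 1 + 1))"
      using \<beta> True by (subst nn_integral_cmult) (measurable, subst nn_integral_powr_left, auto)
    also have "\<dots> = ennreal (1 / Gamma (\<beta> + 1)) * ennreal ((u - w) powr \<beta>)"
      using G0 \<beta> by (simp add: G1 flip: ennreal_mult'')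
    finally show ?thesis using True by simp
  next
    case False
    hence "cell_kernel \<alpha> k l u w v = 0" for v using assms(1) by (auto simp: cell_kernel_def)
    with False show ?thesis by auto
  qed
  hence "(\<integral>\<^sup>+w. \<integral>\<^sup>+v. ennreal (cell_kernel \<alpha> k l u w v) \<partial>lborel \<partial>lborel) =
      ennreal (1 / Gamma (\<beta> + 1)) * ennreal ((u - l) powr (\<beta> + 1) / (\<beta> + 1))"
    using \<beta> assms by (simp, subst nn_integral_cmult) (measurable, subst nn_integral_powr_right, auto)
  also have "\<dots> = ennreal (cell_mass \<alpha> k (u - l))"
    using G0 \<beta> by (simp add: cell_mass_def G2 mult.commute flip: ennreal_mult'' \<beta>_def)
  finally show ?thesis .
qed

abbreviation mlp_measure :: "nat \<Rightarrow> (nat \<Rightarrow> nat) \<Rightarrow> ((nat \<Rightarrow> real) \<times> (nat \<Rightarrow> real)) measure" where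
  "mlp_measure q k \<equiv> PiM {i \<in> {1..q}. k i \<ge> 2} (\<lambda>_. lborel) \<Otimes>\<^sub>M PiM {1..q} (\<lambda>_. lborel)"

lemma mlp_measure_x' [measurable]:
  "i \<in> {1..q} \<Longrightarrow> k i \<ge> 2 \<Longrightarrow> (\<lambda>p. fst p i) \<in> borel_measurable (mlp_measure q k)"
  by (rule measurable_compose[OF measurable_fst]) (auto intro!: measurable_component_singleton[where M = "\<lambda>_. lborel", simplified])

lemma mlp_measure_x [measurable]:
  "i \<in> {1..q} \<Longrightarrow> (\<lambda>p. snd p i) \<in> borel_measurable (mlp_measure q k)"
  by (rule measurable_compose[OF measurable_snd]) (auto intro!: measurable_component_singleton[where M = "\<lambda>_. lborel", simplified])

lemma cell_kernel_measurable_mlp: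
  "i \<in> {1..q} \<Longrightarrow> (\<lambda>p. cell_kernel \<alpha> (k i) l u (fst p i) (snd p i)) \<in> borel_measurable (mlp_measure q k)"
  by (cases "k i \<ge> 2") (auto intro!: cell_kernel_measurable cell_kernel_measurable_not_ge_2)

text \<open>Without the linking factors the integrand is a product over the cells. By Tonelli all
  \<open>x i\<close> are integrated first, then those \<open>x' i\<close> that exist.\<close>

lemma nn_integral_prod_cell_kernel:
  assumes "\<alpha> > 0" and k: "\<And>i. i \<in> {1..q} \<Longrightarrow> k i \<ge> 1" and lu: "\<And>i. i \<in> {1..q} \<Longrightarrow> l i \<le> u i"
  shows "(\<integral>\<^sup>+p. ennreal (\<Prod>i=1..q. cell_kernel \<alpha> (k i) (l i) (u i) (fst p i) (snd p i)) \<partial>mlp_measure q k) =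
    ennreal (\<Prod>i=1..q. cell_mass \<alpha> (k i) (u i - l i))"
proof -
  define K where "K = {i \<in> {1..q}. k i \<ge> 2}"
  let ?g = "\<lambda>i w v. ennreal (cell_kernel \<alpha> (k i) (l i) (u i) w v)"
  interpret Q: finite_product_sigma_finite "\<lambda>_. lborel :: real measure" "{1..q}"
    by standard auto
  interpret K: product_sigma_finite "\<lambda>_. lborel :: real measure" by standard
  have K: "finite K" "K \<subseteq> {1..q}" by (auto simp: K_def)
  have [measurable]: "(\<lambda>v. ?g i w v) \<in> borel_measurable borel" for i w
    by measurable
  have meas: "(\<lambda>p. \<Prod>i=1..q. ?g i (fst p i) (snd p i)) \<in> borel_measurable (mlp_measure q k)"
    by (intro borel_measurable_prod_ennreal measurable_compose[OF _ measurable_ennreal] cell_kernel_measurable_mlp)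
  have "(\<integral>\<^sup>+p. ennreal (\<Prod>i=1..q. cell_kernel \<alpha> (k i) (l i) (u i) (fst p i) (snd p i)) \<partial>mlp_measure q k) =
      (\<integral>\<^sup>+p. (\<Prod>i=1..q. ?g i (fst p i) (snd p i)) \<partial>mlp_measure q k)"
    by (simp add: prod_ennreal cell_kernel_nonneg assms(1))
  also have "\<dots> = (\<integral>\<^sup>+x'. \<integral>\<^sup>+x. (\<Prod>i=1..q. ?g i (x' i) (x i)) \<partial>PiM {1..q} (\<lambda>_. lborel) \<partial>PiM K (\<lambda>_. lborel))"
    unfolding K_def using Q.nn_integral_fst[OF meas] by simp
  also have "\<dots> = (\<integral>\<^sup>+x'. (\<Prod>i=1..q. \<integral>\<^sup>+v. ?g i (x' i) v \<partial>lborel) \<partial>PiM K (\<lambda>_. lborel))"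
    by (intro nn_integral_cong Q.product_nn_integral_prod) auto
  \<comment> \<open>For \<open>i\<close> outside \<open>K\<close> the integral over
    \<open>x i\<close> does not depend on \<open>x'\<close>; these factors are constants and leave
    the outer integral.\<close>
  also have "\<dots> = (\<integral>\<^sup>+x'. (\<Prod>i\<in>K. \<integral>\<^sup>+v. ?g i (x' i) v \<partial>lborel) * (\<Prod>i\<in>{1..q} - K. ennreal (cell_mass \<alpha> (k i) (u i - l i))) \<partial>PiM K (\<lambda>_. lborel))"
  proof (intro nn_integral_cong)
    fix x' :: "nat \<Rightarrow> real"
    have "(\<Prod>i\<in>{1..q} - K. \<integral>\<^sup>+v. ?g i (x' i) v \<partial>lborel) = (\<Prod>i\<in>{1..q} - K. ennreal (cell_mass \<alpha> (k i) (u i - l i)))"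
      using k lu by (intro prod.cong refl nn_integral_cell_kernel_1) (auto simp: K_def)
    thus "(\<Prod>i=1..q. \<integral>\<^sup>+v. ?g i (x' i) v \<partial>lborel) =
        (\<Prod>i\<in>K. \<integral>\<^sup>+v. ?g i (x' i) v \<partial>lborel) * (\<Prod>i\<in>{1..q} - K. ennreal (cell_mass \<alpha> (k i) (u i - l i)))"
      using K by (subst prod.subset_diff[of K]) (auto simp: mult.commute)
  qed
  also have "\<dots> = (\<integral>\<^sup>+x'. (\<Prod>i\<in>K. \<integral>\<^sup>+v. ?g i (x' i) v \<partial>lborel) \<partial>PiM K (\<lambda>_. lborel)) *
      (\<Prod>i\<in>{1..q} - K. ennreal (cell_mass \<alpha> (k i) (u i - l i)))"
    by (rule nn_integral_multc) measurable
  also have "(\<integral>\<^sup>+x'. (\<Prod>i\<in>K. \<integral>\<^sup>+v. ?g i (x' i) v \<partial>lborel) \<partial>PiM K (\<lambda>_. lborel)) =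
      (\<Prod>i\<in>K. \<integral>\<^sup>+w. \<integral>\<^sup>+v. ?g i w v \<partial>lborel \<partial>lborel)"
    using K(1) by (rule K.product_nn_integral_prod) measurable
  also have "\<dots> = (\<Prod>i\<in>K. ennreal (cell_mass \<alpha> (k i) (u i - l i)))"
    using lu assms(1) by (intro prod.cong refl nn_integral_cell_kernel_2) (auto simp: K_def)
  also have "\<dots> * (\<Prod>i\<in>{1..q} - K. ennreal (cell_mass \<alpha> (k i) (u i - l i))) = (\<Prod>i=1..q. ennreal (cell_mass \<alpha> (k i) (u i - l i)))"
    using K by (subst prod.subset_diff[of K]) (auto simp: mult.commute)
  also have "\<dots> = ennreal (\<Prod>i=1..q. cell_mass \<alpha> (k i) (u i - l i))"
    using k assms(1) by (intro prod_ennreal cell_mass_nonneg) auto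
  finally show ?thesis .
qed

text \<open>The earliest point of cell \<open>i\<close> is \<open>x' i\<close> if it exists and
  \<open>x i\<close> otherwise. With this convention the two products of linking factors merge into
  one, and everything else, including the indicator, splits into one kernel per cell: outside the
  region some kernel vanishes.\<close>

lemma mlp_integrand_on_region:
  fixes t :: "nat \<Rightarrow> real" and C :: "nat set"
  assumes "card C \<ge> 1" "\<And>i. i \<in> {1..card C} \<Longrightarrow> k i \<ge> 1"
  defines "q \<equiv> card C" and "\<tau> \<equiv> t (nth_elem C (card C))"
  defines "l \<equiv> \<lambda>i. t (nth_elem C i - 1) / \<tau>" and "u \<equiv> \<lambda>i. t (nth_elem C i) / \<tau>"
  shows "indicator (mlp_region t C k) p *\<^sub>R mlp_integrand \<alpha> q k p =
    (\<Prod>i=2..q. 1 / Gamma \<alpha> * ((if k i \<ge> 2 then fst p i else snd p i) - snd p (i - 1)) powr (\<alpha> - 1)) *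
    (\<Prod>i=1..q. cell_kernel \<alpha> (k i) (l i) (u i) (fst p i) (snd p i))"
    (is "_ = ?W * ?P")
proof -
  obtain x' x where p: "p = (x', x)" by fastforce
  have k1: "k i = 1 \<longleftrightarrow> \<not> k i \<ge> 2" if "i \<in> {1..q}" for i
    using assms(2)[of i] that by (auto simp: q_def)
  have region: "p \<in> mlp_region t C k \<longleftrightarrow>
      (\<forall>i\<in>{1..q}. if k i \<ge> 2 then l i < x' i \<and> x' i < x i \<and> x i < u i else l i < x i \<and> x i < u i)"
    using k1 unfolding mlp_region_def Let_def p q_def \<tau>_def l_def u_def by auto
  let ?ck = "\<lambda>i. cell_kernel \<alpha> (k i) (l i) (u i) (x' i) (x i)"
  show ?thesis
  proof (cases "p \<in> mlp_region t C k")
    case False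
    then obtain i where "i \<in> {1..q}" "?ck i = 0"
      unfolding region by (auto simp: cell_kernel_def split: if_splits)
    hence "?P = 0" by (intro prod_zero) (auto simp: p)
    with False show ?thesis by simp
  next
    case True
    let ?c = "\<lambda>i. 1 / Gamma \<alpha> * ((if k i \<ge> 2 then x' i else x i) - x (i - 1)) powr (\<alpha> - 1)"
    have ck: "?ck i = (if k i \<ge> 2 then (x i - x' i) powr (\<alpha> * (real (k i) - 1) - 1) / Gamma ((real (k i) - 1) * \<alpha>) else 1)"
      if "i \<in> {1..q}" for i
      using True that unfolding region by (auto simp: cell_kernel_def)
    have "{1..q} = insert 1 {2..q}" using assms(1) by (auto simp: q_def)
    hence "?P = ?ck 1 * (\<Prod>i\<in>{2..q}. ?ck i)" by (simp add: p)
    hence "?W * ?P = ?ck 1 * (\<Prod>i\<in>{2..q}. ?c i * ?ck i)"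
      by (simp only: p fst_conv snd_conv prod.distrib mult_ac)
    also have "(\<Prod>i\<in>{2..q}. ?c i * ?ck i) = (\<Prod>i\<in>{i \<in> {2..q}. k i \<ge> 2} \<union> {j \<in> {2..q}. k j = 1}. ?c i * ?ck i)"
      using k1 by (intro prod.cong) auto
    also have "\<dots> = (\<Prod>i\<in>{i \<in> {2..q}. k i \<ge> 2}. ?c i * ?ck i) * (\<Prod>i\<in>{j \<in> {2..q}. k j = 1}. ?c i * ?ck i)"
      by (rule prod.union_disjoint) auto
    also have "(\<Prod>i\<in>{i \<in> {2..q}. k i \<ge> 2}. ?c i * ?ck i) = (\<Prod>i\<in>{i \<in> {2..q}. k i \<ge> 2}.
        1 / Gamma \<alpha> * (x' i - x (i - 1)) powr (\<alpha> - 1) *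
        ((x i - x' i) powr (\<alpha> * (real (k i) - 1) - 1) / Gamma ((real (k i) - 1) * \<alpha>)))"
      by (intro prod.cong refl) (auto simp: ck)
    also have "(\<Prod>i\<in>{j \<in> {2..q}. k j = 1}. ?c i * ?ck i) = (\<Prod>j\<in>{j \<in> {2..q}. k j = 1}. 1 / Gamma \<alpha> * (x j - x (j - 1)) powr (\<alpha> - 1))"
    proof (intro prod.cong refl)
      fix j assume j: "j \<in> {j \<in> {2..q}. k j = 1}"
      hence "?ck j = 1" using ck[of j] by simp
      with j show "?c j * ?ck j = 1 / Gamma \<alpha> * (x j - x (j - 1)) powr (\<alpha> - 1)" by simp
    qed
    also have "?ck 1 = (if k 1 > 1 then (x 1 - x' 1) powr (\<alpha> * (real (k 1) - 1) - 1) / Gamma ((real (k 1) - 1) * \<alpha>) else 1)"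
      using assms(1) by (subst ck) (auto simp: q_def)
    finally show ?thesis
      using True by (simp only: p mlp_integrand_def prod.case mult.assoc indicator_simps scaleR_one)
  qed
qed

text \<open>Every linking distance lies between \<open>l i - u (i - 1)\<close> and
  \<open>u i - l (i - 1)\<close>, and \<open>\<alpha> - 1 < 0\<close> reverses the order;
  \<open>sep\<close> keeps the smaller distance positive. For \<open>card C = 1\<close> the linking
  products are empty, so the two bounds coincide and give the exact value.\<close>

lemma mlp_coeff_bounds:
  fixes t :: "nat \<Rightarrow> real" and C :: "nat set"
  assumes \<alpha>: "0 < \<alpha>" "\<alpha> < 1" and q: "card C \<ge> 1" and k: "\<And>i. i \<in> {1..card C} \<Longrightarrow> k i \<ge> 1"
  defines "q \<equiv> card C" and "\<tau> \<equiv> t (nth_elem C (card C))"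
  defines "l \<equiv> \<lambda>i. t (nth_elem C i - 1) / \<tau>" and "u \<equiv> \<lambda>i. t (nth_elem C i) / \<tau>"
  assumes lu: "\<And>i. i \<in> {1..card C} \<Longrightarrow> l i \<le> u i"
    and sep: "\<And>i. i \<in> {2..card C} \<Longrightarrow> u (i - 1) < l i"
  shows "(\<Prod>i=2..q. 1 / Gamma \<alpha> * (u i - l (i - 1)) powr (\<alpha> - 1)) * (\<Prod>i=1..q. cell_mass \<alpha> (k i) (u i - l i))
      \<le> mlp_coeff \<alpha> t C k" (is "?L * ?m \<le> _")
    and "mlp_coeff \<alpha> t C k \<le>
      (\<Prod>i=2..q. 1 / Gamma \<alpha> * (l i - u (i - 1)) powr (\<alpha> - 1)) * (\<Prod>i=1..q. cell_mass \<alpha> (k i) (u i - l i))" (is "_ \<le> ?U * ?m")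
proof -
  let ?y = "\<lambda>p i. if k i \<ge> 2 then fst p i else snd p i"
  let ?W = "\<lambda>p. \<Prod>i=2..q. 1 / Gamma \<alpha> * (?y p i - snd p (i - 1)) powr (\<alpha> - 1)"
  let ?P = "\<lambda>p. \<Prod>i=1..q. cell_kernel \<alpha> (k i) (l i) (u i) (fst p i) (snd p i)"
  let ?N = "mlp_measure q k"
  have G: "Gamma \<alpha> > 0" using \<alpha>(1) by (rule Gamma_real_pos)
  have coeff: "mlp_coeff \<alpha> t C k = (LINT p|?N. ?W p * ?P p)"
    using mlp_integrand_on_region[OF q k, where t = t and \<alpha> = \<alpha>]
    unfolding mlp_coeff_def set_lebesgue_integral_def q_def l_def u_def \<tau>_def by simp
  have P0: "?P p \<ge> 0" for p by (intro prod_nonneg ballI cell_kernel_nonneg \<alpha>)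
  have W0: "?W p \<ge> 0" for p using G by (intro prod_nonneg) auto
  \<comment> \<open>The linking factors are controlled only where no kernel vanishes; elsewhere all
    three expressions are 0.\<close>
  have WP: "?L * ?P p \<le> ?W p * ?P p \<and> ?W p * ?P p \<le> ?U * ?P p" for p
  proof (cases "?P p = 0")
    case True
    show ?thesis unfolding True by simp
  next
    case False
    hence ck: "cell_kernel \<alpha> (k i) (l i) (u i) (fst p i) (snd p i) \<noteq> 0" if "i \<in> {1..q}" for i
      using that by auto
    have x: "l i < snd p i \<and> snd p i < u i" if "i \<in> {1..q}" for i
      using ck[OF that] by (auto simp: cell_kernel_def split: if_splits)
    have y: "l i < ?y p i \<and> ?y p i < u i" if "i \<in> {1..q}" for i
      using ck[OF that] by (auto simp: cell_kernel_def split: if_splits)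
    have "(u i - l (i - 1)) powr (\<alpha> - 1) \<le> (?y p i - snd p (i - 1)) powr (\<alpha> - 1) \<and>
        (?y p i - snd p (i - 1)) powr (\<alpha> - 1) \<le> (l i - u (i - 1)) powr (\<alpha> - 1)" if "i \<in> {2..q}" for i
    proof -
      have "i \<in> {1..q}" "i - 1 \<in> {1..q}" using that by auto
      from x[OF this(2)] y[OF this(1)] sep[of i] that show ?thesis
        using \<alpha>(2) unfolding q_def by (intro conjI powr_mono2') auto
    qed
    hence "?L \<le> ?W p" "?W p \<le> ?U"
      using G by (intro prod_mono conjI mult_nonneg_nonneg mult_left_mono; simp)+
    thus ?thesis using P0[of p] by (intro conjI mult_right_mono)
  qed
  have measP: "?P \<in> borel_measurable ?N"
    by (intro borel_measurable_prod cell_kernel_measurable_mlp)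
  have y_meas: "(\<lambda>p. ?y p i) \<in> borel_measurable ?N" if "i \<in> {2..q}" for i
  proof -
    have "i \<in> {1..q}" using that by auto
    thus ?thesis using mlp_measure_x[of i q k] mlp_measure_x'[of i q k] by (cases "k i \<ge> 2") simp_all
  qed
  have x_meas: "(\<lambda>p. snd p (i - 1)) \<in> borel_measurable ?N" if "i \<in> {2..q}" for i
    using that by (intro mlp_measure_x) auto
  have measW: "?W \<in> borel_measurable ?N"
    by (intro borel_measurable_prod borel_measurable_times powr_real_measurable borel_measurable_diff y_meas x_meas) auto
  have nnP: "(\<integral>\<^sup>+p. ennreal (?P p) \<partial>?N) = ennreal ?m"
    using \<alpha>(1) k lu unfolding q_def by (rule nn_integral_prod_cell_kernel)
  have m0: "?m \<ge> 0" using \<alpha>(1) k unfolding q_def by (intro prod_nonneg ballI cell_mass_nonneg)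
  have intP: "integrable ?N ?P" and LP: "(LINT p|?N. ?P p) = ?m"
    using nn_integral_eq_integrable[OF measP _ m0] nnP P0 by auto
  \<comment> \<open>Monotonicity needs this: the integral of a non-integrable function is 0 by
    convention, which would break the lower bound.\<close>
  have int: "integrable ?N (\<lambda>p. ?W p * ?P p)"
  proof (rule Bochner_Integration.integrable_bound)
    show "integrable ?N (\<lambda>p. ?U * ?P p)" using intP by (rule integrable_mult_right)
    show "AE p in ?N. norm (?W p * ?P p) \<le> norm (?U * ?P p)"
    proof (rule AE_I2)
      fix p
      have "norm (?W p * ?P p) = ?W p * ?P p"
        using W0[of p] P0[of p] by (simp only: real_norm_def abs_of_nonneg mult_nonneg_nonneg)
      also have "\<dots> \<le> ?U * ?P p" by (rule conjunct2[OF WP])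
      also have "\<dots> \<le> norm (?U * ?P p)" by (simp only: real_norm_def abs_ge_self)
      finally show "norm (?W p * ?P p) \<le> norm (?U * ?P p)" .
    qed
  qed (use measW measP in measurable)
  have "?L * ?m = (LINT p|?N. ?L * ?P p)" using LP by simp
  also have "\<dots> \<le> mlp_coeff \<alpha> t C k"
    unfolding coeff by (intro integral_mono integrable_mult_right intP int conjunct1[OF WP])
  finally show "?L * ?m \<le> mlp_coeff \<alpha> t C k" .
  have "mlp_coeff \<alpha> t C k \<le> (LINT p|?N. ?U * ?P p)"
    unfolding coeff by (intro integral_mono integrable_mult_right intP int conjunct2[OF WP])
  also have "\<dots> = ?U * ?m" using LP by simp
  finally show "mlp_coeff \<alpha> t C k \<le> ?U * ?m" .
qed

section \<open>Moments of short increments\<close>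

lemma nth_elem_image_strict_mono:
  assumes "strict_mono_on {1..m} f" "i \<in> {1..m}"
  shows "nth_elem (f ` {1..m}) i = f i"
proof -
  let ?xs = "map f [1..<Suc m]"
  have "sorted_wrt (<) ?xs"
    unfolding sorted_wrt_map
    by (rule sorted_wrt_mono_rel[OF _ sorted_wrt_upt]) (use assms(1) in \<open>auto simp: strict_mono_on_def\<close>)
  hence "sorted_list_of_set (set ?xs) = ?xs"
    by (intro sorted_list_of_set.idem_if_sorted_distinct) (auto simp: strict_sorted_iff)
  moreover have "set ?xs = f ` {1..m}" by (auto simp: atLeastLessThanSuc_atLeastAtMost simp del: upt_Suc)
  ultimately have "sorted_list_of_set (f ` {1..m}) = ?xs" by simp
  thus ?thesis
    using assms(2) nth_map[of "i - 1" "[1..<Suc m]" f] by (auto simp: nth_elem_def simp del: upt_Suc)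
qed

lemma strict_mono_on_atMostI:
  fixes w :: "nat \<Rightarrow> real"
  assumes "\<And>j. j < n \<Longrightarrow> w j < w (Suc j)"
  shows "strict_mono_on {0..n} w"
proof (rule strict_mono_onI)
  fix i j assume "i \<in> {0..n}" "j \<in> {0..n}" "i < j"
  from this(3,2) show "w i < w j"
  proof (induction rule: strict_inc_induct)
    case (base i)
    thus ?case using assms[of i] by auto
  next
    case (step i)
    thus ?case using assms[of i] by force
  qed
qed

lemma cell_mass_pos: "\<alpha> > 0 \<Longrightarrow> k \<ge> 1 \<Longrightarrow> \<delta> > 0 \<Longrightarrow> 0 < cell_mass \<alpha> k \<delta>"
  by (auto simp: cell_mass_def intro!: divide_pos_pos Gamma_real_pos add_nonneg_pos)

lemma cell_mass_scale: "cell_mass \<alpha> k (c * \<delta>) = c powr (\<alpha> * (real k - 1) + 1) * cell_mass \<alpha> k \<delta>"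
  by (simp add: cell_mass_def powr_mult)

context mittag_leffler
begin

lemma rate_pos: "rate > 0"
  using \<alpha> b T by (auto simp: rate_def intro!: divide_pos_pos Gamma_real_pos)

text \<open>One cell, hence no linking factor, and the two bounds on the coefficient meet. The
  difference with \<open>X 0\<close> is kept because this is the form to which stationarity shifts
  an increment.\<close>

lemma initial_increment_moment:
  assumes r: "0 < r" "r \<le> T" and k: "k \<ge> 1"
  shows "integrable M (\<lambda>\<omega>. (X r \<omega> - X 0 \<omega>) ^ k)"
    and "(LINT \<omega>|M. (X r \<omega> - X 0 \<omega>) ^ k) = rate * fact k * cell_mass \<alpha> k r"
proof -
  define t where "t i = (if i = (0::nat) then 0 else r)" for i
  define k' where "k' = (\<lambda>i\<in>{1::nat..1}. k)"
  have t: "t 0 = 0" "strict_mono_on {0..1} t" "t 1 \<le> T"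
    using r by (auto simp: t_def strict_mono_on_def)
  have t_0: "t 0 = 0" and t_1: "t (Suc 0) = r" by (simp_all add: t_def)
  have C: "card {1::nat} = 1" "nth_elem {1} 1 = 1" by (simp_all add: nth_elem_def)
  have k': "k' \<in> mlp_exponents (card {1::nat})" using k by (auto simp: k'_def)
  note mom = increment_moments[OF order_refl t, of "{1}" k', OF _ _ k']
  show "integrable M (\<lambda>\<omega>. (X r \<omega> - X 0 \<omega>) ^ k)"
    using mom(1) C by (simp add: t_def k'_def)
  have "mlp_coeff \<alpha> t {1} k' = cell_mass \<alpha> k 1"
  proof (rule antisym)
    show "mlp_coeff \<alpha> t {1} k' \<le> cell_mass \<alpha> k 1"
      using mlp_coeff_bounds(2)[of \<alpha> "{1}" k' t] \<alpha> C r k by (simp add: t_def k'_def)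
    show "cell_mass \<alpha> k 1 \<le> mlp_coeff \<alpha> t {1} k'"
      using mlp_coeff_bounds(1)[of \<alpha> "{1}" k' t] \<alpha> C r k by (simp add: t_def k'_def)
  qed
  hence "(LINT \<omega>|M. (X r \<omega> - X 0 \<omega>) ^ k) = rate * fact k * (r powr (\<alpha> * (real k - 1) + 1) * cell_mass \<alpha> k 1)"
    using mom(2) C t_0 t_1 by (simp add: k'_def)
  also have "r powr (\<alpha> * (real k - 1) + 1) * cell_mass \<alpha> k 1 = cell_mass \<alpha> k r"
    using cell_mass_scale[of \<alpha> k r 1] by simp
  finally show "(LINT \<omega>|M. (X r \<omega> - X 0 \<omega>) ^ k) = rate * fact k * cell_mass \<alpha> k r" .
qed

text \<open>Stationarity, applied to a partition with a single step, moves the interval to start at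
  0.\<close>

lemma increment_moment:
  assumes "0 \<le> u" "u < v" "v \<le> T" and k: "k \<ge> 1"
  shows "integrable M (\<lambda>\<omega>. (X v \<omega> - X u \<omega>) ^ k)"
    and "(LINT \<omega>|M. (X v \<omega> - X u \<omega>) ^ k) = rate * fact k * cell_mass \<alpha> k (v - u)"
proof -
  define r where "r = v - u"
  have r: "0 < r" "r \<le> T" using assms by (auto simp: r_def)
  define w where "w i = (if i = (0::nat) then 0 else r)" for i
  let ?P = "PiM {1..1::nat} (\<lambda>_. borel :: real measure)"
  let ?f = "\<lambda>h \<omega>. \<lambda>i\<in>{1..1}. X (w i + h) \<omega> - X (w (i - 1) + h) \<omega>"
  have "distr M ?P (?f u) = distr M ?P (\<lambda>\<omega>. \<lambda>i\<in>{1..1}. X (w i) \<omega> - X (w (i - 1)) \<omega>)"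
  proof -
    have "stationary_increments M T X"
      using process by (simp add: mittag_leffler_process_def)
    moreover have "mono_on {0..1} w \<and> 0 \<le> w 0 \<and> 0 \<le> u \<and> w 1 + u \<le> T"
      using assms by (auto simp: w_def r_def mono_on_def)
    ultimately show ?thesis unfolding stationary_increments_def by blast
  qed
  hence distr: "distr M ?P (?f u) = distr M ?P (?f 0)" by simp
  have meas: "?f h \<in> measurable M ?P" if "0 \<le> h" "h + r \<le> T" for h
    using that r by (intro measurable_restrict borel_measurable_diff X_measurable) (auto simp: w_def)
  let ?g = "\<lambda>z :: nat \<Rightarrow> real. z 1 ^ k"
  have g: "?g \<in> borel_measurable ?P"
    by (intro borel_measurable_power measurable_component_singleton) auto
  have f: "?g (?f h \<omega>) = (X (r + h) \<omega> - X h \<omega>) ^ k" for h \<omega> by (simp add: w_def)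
  have mu: "?f u \<in> measurable M ?P" by (rule meas) (use assms in \<open>simp_all add: r_def\<close>)
  have m0: "?f 0 \<in> measurable M ?P" by (rule meas) (use r in simp_all)
  have "integrable (distr M ?P (?f 0)) ?g"
    using initial_increment_moment(1)[OF r k] unfolding integrable_distr_eq[OF m0 g] f by simp
  thus "integrable M (\<lambda>\<omega>. (X v \<omega> - X u \<omega>) ^ k)"
    unfolding distr[symmetric] integrable_distr_eq[OF mu g] f by (simp add: r_def)
  have "(LINT \<omega>|M. (X v \<omega> - X u \<omega>) ^ k) = integral\<^sup>L (distr M ?P (?f u)) ?g"
    unfolding integral_distr[OF mu g] f by (simp add: r_def)
  also have "\<dots> = (LINT \<omega>|M. (X r \<omega> - X 0 \<omega>) ^ k)"
    unfolding distr integral_distr[OF m0 g] f by simp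
  finally show "(LINT \<omega>|M. (X v \<omega> - X u \<omega>) ^ k) = rate * fact k * cell_mass \<alpha> k (v - u)"
    using initial_increment_moment(2)[OF r k] by (simp add: r_def)
qed

text \<open>A joint moment carries one factor \<open>rate\<close>, the product of \<open>m\<close>
  single moments carries \<open>m\<close> of them. Each of the \<open>m - 1\<close> linking factors
  supplies a missing one through
  \<open>1 / Gamma \<alpha> = rate / (b * T powr (\<alpha> - 1))\<close>, and this is the origin of
  the constant in the limit of (iii). The powers of \<open>\<tau>\<close> that come from rescaling
  to the unit interval cancel.\<close>

lemma normalize_joint_moment:
  fixes k :: "nat \<Rightarrow> nat" and x :: "nat \<Rightarrow> real"
  assumes "m \<ge> 1" "\<tau> > 0"
  shows "rate * \<tau> powr (\<alpha> * ((\<Sum>i=1..m. real (k i)) - 1) + 1) *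
      ((\<Prod>i=2..m. 1 / Gamma \<alpha> * (x i / \<tau>) powr (\<alpha> - 1)) * (\<Prod>i=1..m. cell_mass \<alpha> (k i) (d / \<tau>))) =
    (\<Prod>i=2..m. x i powr (\<alpha> - 1) / (b * T powr (\<alpha> - 1))) * (\<Prod>i=1..m. rate * cell_mass \<alpha> (k i) d)"
proof -
  have m: "{1..m} = insert 1 {2..m}" using assms(1) by auto
  have G: "Gamma \<alpha> > 0" using \<alpha>(1) by (rule Gamma_real_pos)
  have c: "b * T powr (\<alpha> - 1) = Gamma \<alpha> * rate" using G by (simp add: rate_def)
  have e1: "(\<Prod>i=2..m. 1 / Gamma \<alpha> * (x i / \<tau>) powr (\<alpha> - 1)) =
      (\<Prod>i=2..m. rate * (x i powr (\<alpha> - 1) / (b * T powr (\<alpha> - 1)))) * (\<Prod>i=2..m. \<tau> powr (1 - \<alpha>))"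
    unfolding prod.distrib[symmetric]
  proof (rule prod.cong[OF refl])
    fix i
    have "(x i / \<tau>) powr (\<alpha> - 1) = x i powr (\<alpha> - 1) / \<tau> powr (\<alpha> - 1)"
      by (rule powr_divide)
    also have "\<dots> = x i powr (\<alpha> - 1) * \<tau> powr (1 - \<alpha>)"
      using powr_minus[of \<tau> "\<alpha> - 1"] by (simp add: divide_inverse)
    finally show "1 / Gamma \<alpha> * (x i / \<tau>) powr (\<alpha> - 1) = rate * (x i powr (\<alpha> - 1) / (b * T powr (\<alpha> - 1))) * \<tau> powr (1 - \<alpha>)"
      unfolding c using rate_pos G by (simp add: field_simps)
  qed
  have e2: "(\<Prod>i=1..m. cell_mass \<alpha> (k i) (d / \<tau>)) =
      (\<Prod>i=1..m. cell_mass \<alpha> (k i) d) * (\<Prod>i=1..m. \<tau> powr - (\<alpha> * (real (k i) - 1) + 1))"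
    unfolding prod.distrib[symmetric]
    using assms cell_mass_scale[of \<alpha> _ "inverse \<tau>" d]
    by (intro prod.cong refl) (simp add: divide_inverse powr_minus inverse_powr mult.commute del: minus_add_distrib)
  \<comment> \<open>The three kinds of powers stem from the prefactor of the series term, the
    \<open>m - 1\<close> linking factors and the \<open>m\<close> cell masses; their exponents add
    up to 0.\<close>
  have e3: "\<tau> powr (\<alpha> * ((\<Sum>i=1..m. real (k i)) - 1) + 1) * (\<Prod>i=2..m. \<tau> powr (1 - \<alpha>)) *
      (\<Prod>i=1..m. \<tau> powr - (\<alpha> * (real (k i) - 1) + 1)) = 1"
  proof -
    have "(\<alpha> * ((\<Sum>i=1..m. real (k i)) - 1) + 1) + (\<Sum>i=2..m. 1 - \<alpha>) + (\<Sum>i=1..m. - (\<alpha> * (real (k i) - 1) + 1)) = 0"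
      using assms(1) by (simp add: sum_negf sum.distrib sum_subtractf algebra_simps of_nat_diff flip: sum_distrib_left)
    moreover have "(\<Prod>i=2..m. \<tau> powr (1 - \<alpha>)) = \<tau> powr (\<Sum>i=2..m. 1 - \<alpha>)"
      "(\<Prod>i=1..m. \<tau> powr - (\<alpha> * (real (k i) - 1) + 1)) = \<tau> powr (\<Sum>i=1..m. - (\<alpha> * (real (k i) - 1) + 1))"
      using assms(2) by (intro powr_sum[symmetric]; auto)+
    ultimately show ?thesis using assms(2) by (simp only: powr_add[symmetric]) simp
  qed
  have e4: "(\<Prod>i=1..m. rate * cell_mass \<alpha> (k i) d) = rate * (\<Prod>i=2..m. rate) * (\<Prod>i=1..m. cell_mass \<alpha> (k i) d)"
    unfolding m prod.distrib by simp
  have swap: "r * p * ((A * B) * (Ms * D)) = (p * B * D) * (r * A * Ms)" for r p A B Ms D :: real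
    by (simp only: mult_ac)
  show ?thesis
    unfolding e1 e2 swap e3 e4 by (simp only: prod.distrib mult_1 mult_ac)
qed

text \<open>On the partition into short intervals and gaps between them, points of consecutive short
  intervals are at a distance within \<open>d\<close> of \<open>t i - t (i - 1)\<close>. The
  factorials and cell masses are the same in numerator and denominator, so only the linking factors
  remain.\<close>

lemma joint_moment_ratio_bounds:
  fixes t :: "nat \<Rightarrow> real" and k :: "nat \<Rightarrow> nat"
  assumes m: "1 \<le> m" and t: "strict_mono_on {1..m} t" "t m \<le> T" and k: "\<And>i. i \<in> {1..m} \<Longrightarrow> 1 \<le> k i"
    and d: "0 < d" "d < t 1" "\<And>i. i \<in> {2..m} \<Longrightarrow> d < t i - t (i - 1)"
  defines "R \<equiv> (LINT \<omega>|M. (\<Prod>i=1..m. nabla d X (t i) \<omega> ^ k i)) / (\<Prod>i=1..m. (LINT \<omega>|M. nabla d X (t i) \<omega> ^ k i))"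
  shows "(\<Prod>i=2..m. (t i - t (i - 1) + d) powr (\<alpha> - 1) / (b * T powr (\<alpha> - 1))) \<le> R"
    and "R \<le> (\<Prod>i=2..m. (t i - t (i - 1) - d) powr (\<alpha> - 1) / (b * T powr (\<alpha> - 1)))"
proof -
  \<comment> \<open>Point \<open>2 * i\<close> of the partition is \<open>t i\<close> and point
    \<open>2 * i - 1\<close> is \<open>t i - d\<close>: even cells are the short intervals, odd
    cells the gaps. The bounds on \<open>d\<close> make the points strictly increasing.\<close>
  define w where "w j = (if j = 0 then 0 else if even j then t (j div 2) else t (Suc j div 2) - d)" for j :: nat
  have w_even: "w (2 * i) = t i" and w_odd: "w (2 * i - 1) = t i - d" if "i \<in> {1..m}" for i
    using that by (auto simp: w_def)
  have w_step: "w j < w (Suc j)" if "j < 2 * m" for j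
  proof (cases "even j")
    case True
    then obtain i where i: "j = 2 * i" by blast
    show ?thesis
    proof (cases "i = 0")
      case False
      thus ?thesis using d(3)[of "Suc i"] that by (simp add: w_def i)
    qed (use d in \<open>simp add: w_def i\<close>)
  next
    case False
    thus ?thesis using d by (auto simp: w_def elim!: oddE)
  qed
  have w: "w 0 = 0" "strict_mono_on {0..2 * m} w" "w (2 * m) \<le> T"
    using w_step w_even[of m] m t by (auto intro: strict_mono_on_atMostI simp: w_def)
  define C where "C = (\<lambda>i. 2 * i) ` {1..m}"
  have C: "C \<subseteq> {1..2 * m}" "C \<noteq> {}" using m by (auto simp: C_def)
  have nth: "nth_elem C i = 2 * i" if "i \<in> {1..m}" for i
    unfolding C_def using that by (intro nth_elem_image_strict_mono) (auto simp: strict_mono_on_def)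
  have card: "card C = m"
    unfolding C_def by (simp add: card_image inj_on_def)
  define \<tau> where "\<tau> = t m"
  have t_pos: "0 < d \<and> d < t i \<and> t i \<le> T" if "i \<in> {1..m}" for i
    using strict_mono_on_leD[OF t(1), of 1 i] strict_mono_on_leD[OF t(1), of i m] that d t by auto
  have \<tau>: "\<tau> > 0" using t_pos[of m] m by (simp add: \<tau>_def)
  define k' where "k' = restrict k {1..m}"
  have k': "k' \<in> mlp_exponents (card C)" using k by (auto simp: k'_def card)
  define p where "p = \<alpha> * ((\<Sum>i=1..m. real (k i)) - 1) + 1"
  let ?F = "\<Prod>i=1..m. fact (k i) :: real"
  let ?m = "\<Prod>i=1..m. rate * cell_mass \<alpha> (k i) d"
  have num: "(LINT \<omega>|M. (\<Prod>i=1..m. nabla d X (t i) \<omega> ^ k i)) = rate * ?F * \<tau> powr p * mlp_coeff \<alpha> w C k'"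
  proof -
    have "(\<Prod>i=1..m. (X (w (nth_elem C i)) \<omega> - X (w (nth_elem C i - 1)) \<omega>) ^ k' i) = (\<Prod>i=1..m. nabla d X (t i) \<omega> ^ k i)" for \<omega>
      by (intro prod.cong refl) (simp add: nth w_even w_odd[simplified] nabla_def k'_def)
    moreover have "w (nth_elem C m) = \<tau>" using m by (simp add: nth w_even \<tau>_def)
    moreover have "(\<Sum>i=1..m. real (k' i)) = (\<Sum>i=1..m. real (k i))" "(\<Prod>i=1..m. fact (k' i)) = ?F"
      by (auto simp: k'_def intro!: sum.cong prod.cong)
    ultimately show ?thesis
      using increment_moments(2)[OF _ w C k'] m unfolding card p_def by simp
  qed
  have den: "(\<Prod>i=1..m. (LINT \<omega>|M. nabla d X (t i) \<omega> ^ k i)) = ?F * ?m"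
  proof -
    have "(LINT \<omega>|M. nabla d X (t i) \<omega> ^ k i) = fact (k i) * (rate * cell_mass \<alpha> (k i) d)" if "i \<in> {1..m}" for i
      using increment_moment(2)[of "t i - d" "t i" "k i"] t_pos[OF that] k[OF that] by (simp add: nabla_def)
    thus ?thesis by (simp add: prod.distrib)
  qed
  have "?m > 0" using rate_pos \<alpha> k d by (intro prod_pos ballI mult_pos_pos cell_mass_pos)
  have "?F > 0" by (intro prod_pos) simp
  have R: "R = rate * \<tau> powr p * mlp_coeff \<alpha> w C k' / ?m"
    unfolding R_def num den using \<open>?F > 0\<close> by simp
  have l: "w (nth_elem C i - 1) / w (nth_elem C (card C)) = (t i - d) / \<tau>"
    and u: "w (nth_elem C i) / w (nth_elem C (card C)) = t i / \<tau>" if "i \<in> {1..m}" for i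
    using that m by (simp_all add: card nth w_even w_odd[simplified] \<tau>_def)
  have mass: "(\<Prod>i=1..card C. cell_mass \<alpha> (k' i) (w (nth_elem C i) / w (nth_elem C (card C)) - w (nth_elem C i - 1) / w (nth_elem C (card C)))) =
      (\<Prod>i=1..m. cell_mass \<alpha> (k i) (d / \<tau>))"
  proof (unfold card, intro prod.cong refl)
    fix i assume i: "i \<in> {1..m}"
    thus "cell_mass \<alpha> (k' i) (w (nth_elem C i) / w (nth_elem C m) - w (nth_elem C i - 1) / w (nth_elem C m)) = cell_mass \<alpha> (k i) (d / \<tau>)"
      unfolding l[unfolded card, OF i] u[unfolded card, OF i] by (simp add: k'_def diff_divide_distrib[symmetric])
  qed
  have lo: "(\<Prod>i=2..card C. 1 / Gamma \<alpha> * (w (nth_elem C i) / w (nth_elem C (card C)) - w (nth_elem C (i - 1) - 1) / w (nth_elem C (card C))) powr (\<alpha> - 1)) =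
      (\<Prod>i=2..m. 1 / Gamma \<alpha> * ((t i - t (i - 1) + d) / \<tau>) powr (\<alpha> - 1))"
  proof (unfold card, intro prod.cong refl)
    fix i assume "i \<in> {2..m}"
    hence i: "i \<in> {1..m}" "i - 1 \<in> {1..m}" by auto
    show "1 / Gamma \<alpha> * (w (nth_elem C i) / w (nth_elem C m) - w (nth_elem C (i - 1) - 1) / w (nth_elem C m)) powr (\<alpha> - 1) =
        1 / Gamma \<alpha> * ((t i - t (i - 1) + d) / \<tau>) powr (\<alpha> - 1)"
      unfolding l[unfolded card, OF i(1)] l[unfolded card, OF i(2)] u[unfolded card, OF i(1)] u[unfolded card, OF i(2)]
      by (simp add: diff_divide_distrib[symmetric] algebra_simps)
  qed
  have hi: "(\<Prod>i=2..card C. 1 / Gamma \<alpha> * (w (nth_elem C i - 1) / w (nth_elem C (card C)) - w (nth_elem C (i - 1)) / w (nth_elem C (card C))) powr (\<alpha> - 1)) =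
      (\<Prod>i=2..m. 1 / Gamma \<alpha> * ((t i - t (i - 1) - d) / \<tau>) powr (\<alpha> - 1))"
  proof (unfold card, intro prod.cong refl)
    fix i assume "i \<in> {2..m}"
    hence i: "i \<in> {1..m}" "i - 1 \<in> {1..m}" by auto
    show "1 / Gamma \<alpha> * (w (nth_elem C i - 1) / w (nth_elem C m) - w (nth_elem C (i - 1)) / w (nth_elem C m)) powr (\<alpha> - 1) =
        1 / Gamma \<alpha> * ((t i - t (i - 1) - d) / \<tau>) powr (\<alpha> - 1)"
      unfolding l[unfolded card, OF i(1)] l[unfolded card, OF i(2)] u[unfolded card, OF i(1)] u[unfolded card, OF i(2)]
      by (simp add: diff_divide_distrib[symmetric] algebra_simps)
  qed
  have lu: "w (nth_elem C i - 1) / w (nth_elem C (card C)) \<le> w (nth_elem C i) / w (nth_elem C (card C))" if "i \<in> {1..card C}" for i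
    using \<tau> d(1) unfolding l[OF that[unfolded card]] u[OF that[unfolded card]] by (simp add: divide_right_mono)
  have sep: "w (nth_elem C (i - 1)) / w (nth_elem C (card C)) < w (nth_elem C i - 1) / w (nth_elem C (card C))" if "i \<in> {2..card C}" for i
  proof -
    have i: "i \<in> {1..m}" "i - 1 \<in> {1..m}" using that card by auto
    show ?thesis using \<tau> d(3)[of i] that card unfolding l[OF i(1)] u[OF i(2)] by (simp add: divide_strict_right_mono)
  qed
  have kC: "1 \<le> k' i" if "i \<in> {1..card C}" for i using that k by (simp add: card k'_def)
  note bounds = mlp_coeff_bounds[OF \<alpha>, of C k' w, OF _ kC lu sep, unfolded mass lo hi]
  have pos: "0 \<le> rate * \<tau> powr p" using rate_pos by simp
  have "(\<Prod>i=2..m. (t i - t (i - 1) + d) powr (\<alpha> - 1) / (b * T powr (\<alpha> - 1))) * ?m =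
      rate * \<tau> powr p * ((\<Prod>i=2..m. 1 / Gamma \<alpha> * ((t i - t (i - 1) + d) / \<tau>) powr (\<alpha> - 1)) * (\<Prod>i=1..m. cell_mass \<alpha> (k i) (d / \<tau>)))"
    unfolding p_def using m \<tau> by (rule normalize_joint_moment[symmetric])
  also have "\<dots> \<le> rate * \<tau> powr p * mlp_coeff \<alpha> w C k'"
    using bounds(1) m card pos by (intro mult_left_mono) auto
  finally show "(\<Prod>i=2..m. (t i - t (i - 1) + d) powr (\<alpha> - 1) / (b * T powr (\<alpha> - 1))) \<le> R"
    unfolding R using \<open>?m > 0\<close> by (simp add: pos_le_divide_eq)
  have "rate * \<tau> powr p * mlp_coeff \<alpha> w C k' \<le>
      rate * \<tau> powr p * ((\<Prod>i=2..m. 1 / Gamma \<alpha> * ((t i - t (i - 1) - d) / \<tau>) powr (\<alpha> - 1)) * (\<Prod>i=1..m. cell_mass \<alpha> (k i) (d / \<tau>)))"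
    using bounds(2) m card pos by (intro mult_left_mono) auto
  also have "\<dots> = (\<Prod>i=2..m. (t i - t (i - 1) - d) powr (\<alpha> - 1) / (b * T powr (\<alpha> - 1))) * ?m"
    unfolding p_def using m \<tau> by (rule normalize_joint_moment)
  finally show "R \<le> (\<Prod>i=2..m. (t i - t (i - 1) - d) powr (\<alpha> - 1) / (b * T powr (\<alpha> - 1)))"
    unfolding R using \<open>?m > 0\<close> by (simp add: pos_divide_le_eq)
qed

lemma joint_moment_ratio_tendsto:
  fixes t :: "nat \<Rightarrow> real" and k :: "nat \<Rightarrow> nat"
  assumes m: "1 \<le> m" and t: "0 < t 1" "strict_mono_on {1..m} t" "t m \<le> T" and k: "\<And>i. i \<in> {1..m} \<Longrightarrow> 1 \<le> k i"
  shows "((\<lambda>d. (LINT \<omega>|M. (\<Prod>i=1..m. nabla d X (t i) \<omega> ^ k i)) / (\<Prod>i=1..m. (LINT \<omega>|M. nabla d X (t i) \<omega> ^ k i)))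
      \<longlongrightarrow> (\<Prod>i=2..m. (t i - t (i - 1)) powr (\<alpha> - 1) / (b * T powr (\<alpha> - 1)))) (at_right 0)"
proof (rule tendsto_sandwich)
  have gap: "0 < t i - t (i - 1)" if "i \<in> {2..m}" for i
    using strict_mono_onD[OF t(2), of "i - 1" i] that by auto
  \<comment> \<open>The bounds require \<open>d\<close> to be smaller than each of the finitely many
    gaps, which holds eventually.\<close>
  have "eventually (\<lambda>d. 0 < d \<and> d < t 1 \<and> (\<forall>i\<in>{2..m}. d < t i - t (i - 1))) (at_right 0)"
    using t(1) gap by (intro eventually_conj eventually_ball_finite ballI)
      (auto simp: eventually_at_right_less intro: order_tendstoD(2)[OF tendsto_ident_at])
  note ev = this
  show "\<forall>\<^sub>F d in at_right 0. (\<Prod>i=2..m. (t i - t (i - 1) + d) powr (\<alpha> - 1) / (b * T powr (\<alpha> - 1))) \<le>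
      (LINT \<omega>|M. (\<Prod>i=1..m. nabla d X (t i) \<omega> ^ k i)) / (\<Prod>i=1..m. (LINT \<omega>|M. nabla d X (t i) \<omega> ^ k i))"
    using ev by eventually_elim (rule joint_moment_ratio_bounds(1)[OF m t(2,3) k], auto)
  show "\<forall>\<^sub>F d in at_right 0. (LINT \<omega>|M. (\<Prod>i=1..m. nabla d X (t i) \<omega> ^ k i)) / (\<Prod>i=1..m. (LINT \<omega>|M. nabla d X (t i) \<omega> ^ k i))
      \<le> (\<Prod>i=2..m. (t i - t (i - 1) - d) powr (\<alpha> - 1) / (b * T powr (\<alpha> - 1)))"
    using ev by eventually_elim (rule joint_moment_ratio_bounds(2)[OF m t(2,3) k], auto)
  have c: "b * T powr (\<alpha> - 1) \<noteq> 0" using b T by simp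
  show "((\<lambda>d. \<Prod>i=2..m. (t i - t (i - 1) + d) powr (\<alpha> - 1) / (b * T powr (\<alpha> - 1)))
      \<longlongrightarrow> (\<Prod>i=2..m. (t i - t (i - 1)) powr (\<alpha> - 1) / (b * T powr (\<alpha> - 1)))) (at_right 0)"
    by (intro tendsto_prod tendsto_divide tendsto_powr tendsto_const c)
      (use gap in \<open>force intro!: tendsto_eq_intros\<close>)+
  show "((\<lambda>d. \<Prod>i=2..m. (t i - t (i - 1) - d) powr (\<alpha> - 1) / (b * T powr (\<alpha> - 1)))
      \<longlongrightarrow> (\<Prod>i=2..m. (t i - t (i - 1)) powr (\<alpha> - 1) / (b * T powr (\<alpha> - 1)))) (at_right 0)"
    by (intro tendsto_prod tendsto_divide tendsto_powr tendsto_const c)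
      (use gap in \<open>force intro!: tendsto_eq_intros\<close>)+
qed

end

section \<open>Second-order asymptotics\<close>

text \<open>A symmetric second difference quotient, whose limit is the second derivative of
  \<open>\<lambda>h. h powr p\<close>.\<close>

lemma second_difference_powr_tendsto:
  fixes h p :: real
  assumes "h > 0"
  shows "((\<lambda>x. ((h + x) powr p - 2 * h powr p + (h - x) powr p) / x\<^sup>2) \<longlongrightarrow> p * (p - 1) * h powr (p - 2)) (at_right 0)"
proof -
  have "h powr (p - 2) = h powr p / h\<^sup>2"
    using assms by (simp add: powr_diff powr_numeral)
  moreover have "((\<lambda>x. ((h + x) powr p - 2 * h powr p + (h - x) powr p) / x\<^sup>2) \<longlongrightarrow> p * (p - 1) * (h powr p / h\<^sup>2)) (at_right 0)"
    using assms by real_asymp (simp add: divide_simps power2_eq_square)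
  ultimately show ?thesis by simp
qed

lemma asymp_equiv_square_scaled:
  fixes f :: "real \<Rightarrow> real"
  assumes "((\<lambda>\<Delta>. f \<Delta> / \<Delta>\<^sup>2) \<longlongrightarrow> c * L) (at_right 0)" "c * L \<noteq> 0"
  shows "f \<sim>[at_right 0] (\<lambda>\<Delta>. \<Delta>\<^sup>2 * c * L)"
proof (rule asymp_equivI')
  have "((\<lambda>\<Delta>. f \<Delta> / \<Delta>\<^sup>2 / (c * L)) \<longlongrightarrow> c * L / (c * L)) (at_right 0)"
    using assms by (intro tendsto_divide tendsto_const)
  thus "((\<lambda>\<Delta>. f \<Delta> / (\<Delta>\<^sup>2 * c * L)) \<longlongrightarrow> 1) (at_right 0)"
    using assms(2) by (simp add: mult.assoc)
qed

context mittag_leffler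
begin

lemma Gamma_plus_2: "Gamma (\<alpha> + 2) = (\<alpha> + 1) * \<alpha> * Gamma \<alpha>"
proof -
  have "\<alpha> \<notin> \<int>\<^sub>\<le>\<^sub>0" "\<alpha> + 1 \<notin> \<int>\<^sub>\<le>\<^sub>0" using \<alpha> by (auto elim!: nonpos_Ints_cases)
  thus ?thesis using Gamma_plus1[of "\<alpha> + 1"] Gamma_plus1[of \<alpha>] by (simp add: add.assoc)
qed

lemma Gamma_pos: "Gamma \<alpha> > 0" "Gamma (\<alpha> + 2) > 0"
  using \<alpha> by (auto intro: Gamma_real_pos)

text \<open>The second moment of an increment of length \<open>r\<close>:
  \<open>rate * fact 2 * cell_mass \<alpha> 2 r\<close>.\<close>

definition sq_mean :: "real \<Rightarrow> real" where
  "sq_mean r = 2 * rate * r powr (\<alpha> + 1) / Gamma (\<alpha> + 2)"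

lemma increment_mean:
  assumes "0 \<le> u" "u < v" "v \<le> T"
  shows "integrable M (\<lambda>\<omega>. X v \<omega> - X u \<omega>)" "(LINT \<omega>|M. X v \<omega> - X u \<omega>) = rate * (v - u)"
  using increment_moment[OF assms, of 1] assms Gamma_fact[of 1, where 'a = real] by (simp_all add: cell_mass_def)

lemma increment_sq_mean:
  assumes "0 \<le> u" "u < v" "v \<le> T"
  shows "integrable M (\<lambda>\<omega>. (X v \<omega> - X u \<omega>)\<^sup>2)" "(LINT \<omega>|M. (X v \<omega> - X u \<omega>)\<^sup>2) = sq_mean (v - u)"
  using increment_moment[OF assms, of 2] by (simp_all add: cell_mass_def sq_mean_def)

text \<open>Polarization over the four points \<open>t - d\<close>, \<open>t\<close>,
  \<open>s - d\<close>, \<open>s\<close>, valid whether or not the increments overlap. When they do,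
  the increment from \<open>t\<close> to \<open>s - d\<close> runs backwards, hence the absolute
  value; at lag \<open>d\<close> it degenerates, while the moment formula asks for a proper
  interval.\<close>

lemma nabla_product:
  assumes d: "0 < d" "d \<le> t" and ts: "t < s" "s \<le> T" "s - t \<noteq> d"
  shows "integrable M (\<lambda>\<omega>. nabla d X t \<omega> * nabla d X s \<omega>)"
    and "(LINT \<omega>|M. nabla d X t \<omega> * nabla d X s \<omega>) =
      (sq_mean (s - t + d) + sq_mean \<bar>s - t - d\<bar> - 2 * sq_mean (s - t)) / 2"
proof -
  let ?Q = "\<lambda>u v \<omega>. (X v \<omega> - X u \<omega>)\<^sup>2"
  have eq: "nabla d X t \<omega> * nabla d X s \<omega> =
      (?Q (t - d) s \<omega> + ?Q t (s - d) \<omega> - ?Q t s \<omega> - ?Q (t - d) (s - d) \<omega>) / 2" for \<omega>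
    by (simp add: nabla_def power2_eq_square field_simps)
  have mid: "integrable M (?Q t (s - d)) \<and> (LINT \<omega>|M. ?Q t (s - d) \<omega>) = sq_mean \<bar>s - t - d\<bar>"
  proof (cases "t < s - d")
    case True
    thus ?thesis using increment_sq_mean[of t "s - d"] d ts by (simp add: algebra_simps)
  next
    case False
    moreover have "?Q t (s - d) = ?Q (s - d) t" by (simp add: power2_commute fun_eq_iff)
    ultimately show ?thesis using increment_sq_mean[of "s - d" t] d ts by (simp add: algebra_simps)
  qed
  note q = increment_sq_mean[of "t - d" s] increment_sq_mean[of t s] increment_sq_mean[of "t - d" "s - d"]
  show "integrable M (\<lambda>\<omega>. nabla d X t \<omega> * nabla d X s \<omega>)"
    unfolding eq using q mid d ts by simp
  show "(LINT \<omega>|M. nabla d X t \<omega> * nabla d X s \<omega>) =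
      (sq_mean (s - t + d) + sq_mean \<bar>s - t - d\<bar> - 2 * sq_mean (s - t)) / 2"
    unfolding eq using q mid d ts by (simp add: algebra_simps)
qed

lemma nabla_product_closed_form:
  assumes "0 < d" "d \<le> t" "t < s" "s \<le> T" "s - t > d"
  shows "(LINT \<omega>|M. nabla d X t \<omega> * nabla d X s \<omega>) =
    b * T powr (\<alpha> - 1) / (Gamma \<alpha> * Gamma (\<alpha> + 2)) *
    ((s - t + d) powr (\<alpha> + 1) - 2 * (s - t) powr (\<alpha> + 1) + (s - t - d) powr (\<alpha> + 1))"
proof -
  have sq: "sq_mean r = 2 * (b * T powr (\<alpha> - 1) / (Gamma \<alpha> * Gamma (\<alpha> + 2)) * r powr (\<alpha> + 1))" for r
    by (simp add: sq_mean_def rate_def)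
  have ring: "(2 * (K * x) + 2 * (K * z) - 2 * (2 * (K * y))) / 2 = K * (x - 2 * y + z)" for K x y z :: real
    by (simp add: field_simps)
  have "\<bar>s - t - d\<bar> = s - t - d" using assms by simp
  thus ?thesis
    using nabla_product(2)[of d t s] assms by (simp only: sq ring)
qed

lemma nabla_mean:
  assumes "0 < d" "d \<le> t" "t \<le> T"
  shows "integrable M (nabla d X t)" "(LINT \<omega>|M. nabla d X t \<omega>) = rate * d"
  using increment_mean[of "t - d" t] assms by (simp_all add: nabla_def[abs_def])

lemma cov_nabla:
  assumes "0 < d" "d \<le> t" "t < s" "s \<le> T" "s - t \<noteq> d"
  shows "cov M (nabla d X t) (nabla d X s) = (LINT \<omega>|M. nabla d X t \<omega> * nabla d X s \<omega>) - rate\<^sup>2 * d\<^sup>2"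
proof -
  note m = nabla_mean[of d t] nabla_mean[of d s]
  have "cov M (nabla d X t) (nabla d X s) =
      (LINT \<omega>|M. nabla d X t \<omega> * nabla d X s \<omega> - rate * d * nabla d X t \<omega> - rate * d * nabla d X s \<omega> + rate\<^sup>2 * d\<^sup>2)"
    unfolding cov_def using m assms by (simp add: algebra_simps power2_eq_square)
  also have "\<dots> = (LINT \<omega>|M. nabla d X t \<omega> * nabla d X s \<omega>) - rate\<^sup>2 * d\<^sup>2"
    using m assms nabla_product(1)[of d t s] by (simp add: prob_space power2_eq_square)
  finally show ?thesis .
qed

lemma var_nabla:
  assumes "0 < d" "d \<le> t" "t \<le> T"
  shows "var M (nabla d X t) = sq_mean d - rate\<^sup>2 * d\<^sup>2"
proof -
  have "var M (nabla d X t) = variance (nabla d X t)" by (simp add: var_def)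
  also have "\<dots> = (LINT \<omega>|M. (nabla d X t \<omega>)\<^sup>2) - (rate * d)\<^sup>2"
    using nabla_mean[of d t] increment_sq_mean[of "t - d" t] assms
    by (subst variance_eq) (simp_all add: nabla_def[abs_def])
  also have "(LINT \<omega>|M. (nabla d X t \<omega>)\<^sup>2) = sq_mean d"
    using increment_sq_mean[of "t - d" t] assms by (simp add: nabla_def)
  finally show ?thesis by (simp add: power_mult_distrib)
qed

lemma var_nabla_nonneg: "var M (nabla d X t) \<ge> 0"
  unfolding var_def by (intro integral_nonneg_AE) auto

text \<open>Both variances have the same value, so the root of their product is that value itself,
  being nonnegative.\<close>

lemma corr_nabla:
  assumes "0 < d" "d \<le> t" "t \<le> T" "d \<le> s" "s \<le> T"
  shows "corr M (nabla d X t) (nabla d X s) = cov M (nabla d X t) (nabla d X s) / (sq_mean d - rate\<^sup>2 * d\<^sup>2)"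
  using var_nabla_nonneg[of d t] var_nabla[of d t] var_nabla[of d s] assms
  by (simp add: corr_def real_sqrt_mult_self flip: power2_eq_square)

text \<open>Factored so that \<open>d\<^sup>2\<close> and \<open>c'\<close> cancel against the
  covariance; the constant \<open>2 / (\<alpha> * (\<alpha> + 1))\<close> comes from expanding
  \<open>Gamma (\<alpha> + 2)\<close>.\<close>

lemma variance_formula:
  assumes "0 < d"
  shows "sq_mean d - rate\<^sup>2 * d\<^sup>2 = d\<^sup>2 * (b * T powr (\<alpha> - 1) / (Gamma \<alpha>)\<^sup>2) *
    (2 / (\<alpha> * (\<alpha> + 1)) * d powr (\<alpha> - 1) - b * T powr (\<alpha> - 1))"
proof -
  have "d powr (\<alpha> + 1) = d\<^sup>2 * d powr (\<alpha> - 1)"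
    using assms powr_add[of d 2 "\<alpha> - 1"] by (simp add: powr_numeral add.commute)
  hence "sq_mean d = d\<^sup>2 * (rate / Gamma \<alpha>) * (2 / (\<alpha> * (\<alpha> + 1)) * d powr (\<alpha> - 1))"
    by (simp add: sq_mean_def Gamma_plus_2 mult_ac)
  moreover have "rate\<^sup>2 = rate / Gamma \<alpha> * (b * T powr (\<alpha> - 1))"
    "rate / Gamma \<alpha> = b * T powr (\<alpha> - 1) / (Gamma \<alpha>)\<^sup>2"
    by (simp_all add: rate_def power2_eq_square)
  ultimately show ?thesis by (simp only: right_diff_distrib mult_ac)
qed

text \<open>From \<open>b \<le> 1\<close>, \<open>d \<le> T\<close> and \<open>\<alpha> < 1\<close>
  follows \<open>b * T powr (\<alpha> - 1) \<le> d powr (\<alpha> - 1)\<close>; the inequality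
  becomes strict since \<open>\<alpha> * (\<alpha> + 1) < 2\<close>.\<close>

lemma variance_pos:
  assumes "0 < d" "d \<le> T"
  shows "2 / (\<alpha> * (\<alpha> + 1)) * d powr (\<alpha> - 1) - b * T powr (\<alpha> - 1) > 0" "sq_mean d - rate\<^sup>2 * d\<^sup>2 > 0"
proof -
  have "\<alpha> * (\<alpha> + 1) < 1 * 2" using \<alpha> by (intro mult_strict_mono) auto
  hence c: "1 < 2 / (\<alpha> * (\<alpha> + 1))" using \<alpha> by simp
  have "b * T powr (\<alpha> - 1) \<le> 1 * d powr (\<alpha> - 1)"
    using b \<alpha> assms by (intro mult_mono powr_mono2') auto
  also have "\<dots> < 2 / (\<alpha> * (\<alpha> + 1)) * d powr (\<alpha> - 1)"
    using c assms by (intro mult_strict_right_mono) auto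
  finally show 1: "2 / (\<alpha> * (\<alpha> + 1)) * d powr (\<alpha> - 1) - b * T powr (\<alpha> - 1) > 0" by simp
  show "sq_mean d - rate\<^sup>2 * d\<^sup>2 > 0"
    unfolding variance_formula[OF assms(1)] using 1 b T assms Gamma_pos
    by (intro mult_pos_pos divide_pos_pos) auto
qed

section \<open>Two fixed times, increments of vanishing length\<close>

context
  fixes t s :: real
  assumes ts: "0 < t" "t < s" "s \<le> T"
begin

lemma eventually_small_lag: "\<forall>\<^sub>F \<Delta> in at_right 0. 0 < \<Delta> \<and> \<Delta> \<le> t \<and> \<Delta> < s - t"
  using ts eventually_at_right_real[of 0 "min t (s - t)"] by (auto elim: eventually_mono)

text \<open>The second derivative brings a factor \<open>(\<alpha> + 1) * \<alpha>\<close> that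
  cancels inside \<open>Gamma (\<alpha> + 2)\<close>; what is left of the two Gamma values is the
  square of \<open>Gamma \<alpha>\<close> in \<open>c'\<close>.\<close>

lemma nabla_product_scaled_tendsto:
  "((\<lambda>\<Delta>. (LINT \<omega>|M. nabla \<Delta> X t \<omega> * nabla \<Delta> X s \<omega>) / \<Delta>\<^sup>2) \<longlongrightarrow>
    b * T powr (\<alpha> - 1) / (Gamma \<alpha>)\<^sup>2 * (s - t) powr (\<alpha> - 1)) (at_right 0)"
proof -
  let ?c = "b * T powr (\<alpha> - 1) / (Gamma \<alpha> * Gamma (\<alpha> + 2))"
  have "((\<lambda>\<Delta>. ?c * (((s - t + \<Delta>) powr (\<alpha> + 1) - 2 * (s - t) powr (\<alpha> + 1) + (s - t - \<Delta>) powr (\<alpha> + 1)) / \<Delta>\<^sup>2)) \<longlongrightarrow>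
      ?c * ((\<alpha> + 1) * (\<alpha> + 1 - 1) * (s - t) powr (\<alpha> + 1 - 2))) (at_right 0)"
    using ts by (intro tendsto_mult_left second_difference_powr_tendsto) auto
  also have "?c * ((\<alpha> + 1) * (\<alpha> + 1 - 1) * (s - t) powr (\<alpha> + 1 - 2)) = b * T powr (\<alpha> - 1) / (Gamma \<alpha>)\<^sup>2 * (s - t) powr (\<alpha> - 1)"
  proof -
    have "q \<noteq> 0 \<Longrightarrow> x / (G * (q * G)) * (q * h) = x / G\<^sup>2 * h" for q x G h :: real
      by (simp add: power2_eq_square)
    from this[of "(\<alpha> + 1) * \<alpha>"] show ?thesis unfolding Gamma_plus_2 using \<alpha> by (simp add: power2_eq_square)
  qed
  finally show ?thesis
    by (rule Lim_transform_eventually)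
      (use eventually_small_lag in eventually_elim, use ts nabla_product_closed_form[of _ t s] in auto)
qed

text \<open>Strict because \<open>t > 0\<close> forces \<open>s - t < T\<close>. The scaled limit of
  the covariance must not vanish, or it would not determine an asymptotic equivalent.\<close>

lemma cov_limit_pos: "(s - t) powr (\<alpha> - 1) - b * T powr (\<alpha> - 1) > 0"
proof -
  have "b * T powr (\<alpha> - 1) \<le> 1 * T powr (\<alpha> - 1)" using b by (intro mult_right_mono) auto
  also have "\<dots> < (s - t) powr (\<alpha> - 1)"
    using ts \<alpha> powr_less_mono2_neg[of "\<alpha> - 1" "s - t" T] by simp
  finally show ?thesis by simp
qed

lemma nabla_product_asymp:
  "(\<lambda>\<Delta>. LINT \<omega>|M. nabla \<Delta> X t \<omega> * nabla \<Delta> X s \<omega>) \<sim>[at_right 0]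
    (\<lambda>\<Delta>. \<Delta>\<^sup>2 * (b * T powr (\<alpha> - 1) / (Gamma \<alpha>)\<^sup>2) * (s - t) powr (\<alpha> - 1))"
  using nabla_product_scaled_tendsto
  by (rule asymp_equiv_square_scaled) (use b T ts Gamma_pos in simp)

lemma cov_nabla_asymp:
  "(\<lambda>\<Delta>. cov M (nabla \<Delta> X t) (nabla \<Delta> X s)) \<sim>[at_right 0]
    (\<lambda>\<Delta>. \<Delta>\<^sup>2 * (b * T powr (\<alpha> - 1) / (Gamma \<alpha>)\<^sup>2) * ((s - t) powr (\<alpha> - 1) - b * T powr (\<alpha> - 1)))"
proof (rule asymp_equiv_square_scaled)
  let ?c = "b * T powr (\<alpha> - 1) / (Gamma \<alpha>)\<^sup>2"
  have "((\<lambda>\<Delta>. (LINT \<omega>|M. nabla \<Delta> X t \<omega> * nabla \<Delta> X s \<omega>) / \<Delta>\<^sup>2 - rate\<^sup>2) \<longlongrightarrow>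
      ?c * (s - t) powr (\<alpha> - 1) - rate\<^sup>2) (at_right 0)"
    by (intro tendsto_diff nabla_product_scaled_tendsto tendsto_const)
  also have "?c * (s - t) powr (\<alpha> - 1) - rate\<^sup>2 = ?c * ((s - t) powr (\<alpha> - 1) - b * T powr (\<alpha> - 1))"
    by (simp add: rate_def power2_eq_square algebra_simps)
  finally show "((\<lambda>\<Delta>. cov M (nabla \<Delta> X t) (nabla \<Delta> X s) / \<Delta>\<^sup>2) \<longlongrightarrow> \<dots>) (at_right 0)"
  proof (rule Lim_transform_eventually)
    show "\<forall>\<^sub>F \<Delta> in at_right 0. (LINT \<omega>|M. nabla \<Delta> X t \<omega> * nabla \<Delta> X s \<omega>) / \<Delta>\<^sup>2 - rate\<^sup>2 =
        cov M (nabla \<Delta> X t) (nabla \<Delta> X s) / \<Delta>\<^sup>2"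
      using eventually_small_lag
      by eventually_elim (use ts in \<open>simp add: cov_nabla diff_divide_distrib\<close>)
  qed
  show "?c * ((s - t) powr (\<alpha> - 1) - b * T powr (\<alpha> - 1)) \<noteq> 0"
    using cov_limit_pos b T Gamma_pos by simp
qed

text \<open>The variance is known exactly, so it suffices to divide both sides of the covariance
  equivalence by its factored form.\<close>

lemma corr_nabla_asymp:
  "(\<lambda>\<Delta>. corr M (nabla \<Delta> X t) (nabla \<Delta> X s)) \<sim>[at_right 0]
    (\<lambda>\<Delta>. ((s - t) powr (\<alpha> - 1) - b * T powr (\<alpha> - 1)) /
      (2 / (\<alpha> * (\<alpha> + 1)) * \<Delta> powr (\<alpha> - 1) - b * T powr (\<alpha> - 1)))"
proof -
  let ?c = "b * T powr (\<alpha> - 1) / (Gamma \<alpha>)\<^sup>2"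
  let ?K = "(s - t) powr (\<alpha> - 1) - b * T powr (\<alpha> - 1)"
  let ?D = "\<lambda>\<Delta>. 2 / (\<alpha> * (\<alpha> + 1)) * \<Delta> powr (\<alpha> - 1) - b * T powr (\<alpha> - 1)"
  have c: "?c \<noteq> 0" using b T Gamma_pos by simp
  have "(\<lambda>\<Delta>. cov M (nabla \<Delta> X t) (nabla \<Delta> X s) / (\<Delta>\<^sup>2 * ?c * ?D \<Delta>)) \<sim>[at_right 0] (\<lambda>\<Delta>. \<Delta>\<^sup>2 * ?c * ?K / (\<Delta>\<^sup>2 * ?c * ?D \<Delta>))"
    by (intro asymp_equiv_intros cov_nabla_asymp)
  moreover have "\<forall>\<^sub>F \<Delta> in at_right 0. cov M (nabla \<Delta> X t) (nabla \<Delta> X s) / (\<Delta>\<^sup>2 * ?c * ?D \<Delta>) = corr M (nabla \<Delta> X t) (nabla \<Delta> X s)"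
    using eventually_small_lag
    by eventually_elim (use ts in \<open>simp add: corr_nabla variance_formula\<close>)
  moreover have "\<forall>\<^sub>F \<Delta> in at_right 0. \<Delta>\<^sup>2 * ?c * ?K / (\<Delta>\<^sup>2 * ?c * ?D \<Delta>) = ?K / ?D \<Delta>"
    using eventually_small_lag by eventually_elim (use c in \<open>simp only: mult.assoc\<close>, use c in simp)
  ultimately show ?thesis by (rule asymp_equiv_transfer)
qed

end

section \<open>Overlapping increments of fixed length, vanishing lag\<close>

context
  fixes d :: real
  assumes d: "0 < d"
begin

lemma eventually_lag_to_zero:
  "\<forall>\<^sub>F (t, s) in lag_to_zero d T. d \<le> t \<and> t < s \<and> s \<le> T \<and> s - t < d"
  unfolding lag_to_zero_def by (intro eventually_inf_principal[THEN iffD2]) auto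

text \<open>The correlation depends on the two times through their lag alone, so equivalences in one
  variable at \<open>at_right 0\<close> pass to pairs of times by composition with this
  limit.\<close>

lemma filterlim_lag: "filterlim (\<lambda>(t, s). s - t) (at_right 0) (lag_to_zero d T)"
  unfolding at_within_def
proof (intro filterlim_inf[THEN iffD2] conjI)
  show "filterlim (\<lambda>(t, s). s - t) (nhds 0) (lag_to_zero d T)"
    unfolding lag_to_zero_def by (rule filterlim_mono[OF filterlim_filtercomap order_refl inf_le1])
  show "filterlim (\<lambda>(t, s). s - t) (principal ({0<..} - {0})) (lag_to_zero d T)"
    unfolding filterlim_principal using eventually_lag_to_zero by eventually_elim auto
qed

text \<open>No pair of times is admissible here, so equivalences hold vacuously; positivity of the
  variance is at hand only for \<open>d \<le> T\<close>.\<close>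

lemma lag_to_zero_eq_bot: "d \<ge> T \<Longrightarrow> lag_to_zero d T = bot"
proof -
  assume "d \<ge> T"
  hence empty: "{(t, s). d \<le> t \<and> t < s \<and> s \<le> T \<and> s - t < d} = {}" by auto
  show "lag_to_zero d T = bot" unfolding lag_to_zero_def empty by simp
qed

text \<open>The time enters only through the variance, which is the same at all admissible
  times.\<close>

definition corr_coeff :: "real \<Rightarrow> real" where
  "corr_coeff t = 2 * b * T powr (\<alpha> - 1) / (Gamma \<alpha> * Gamma (\<alpha> + 2) * var M (nabla d X t))"

text \<open>As a function of the lag \<open>h\<close>, one minus the correlation is exactly
  \<open>F h\<close>: a multiple of \<open>h powr (\<alpha> + 1)\<close> corrected by a second
  difference of higher order. The first equivalence carries the constant; for the second it is
  enough that both sides tend to 1.\<close>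

lemma corr_lag_to_zero:
  "(\<lambda>(t, s). 1 - corr M (nabla d X t) (nabla d X s)) \<sim>[lag_to_zero d T] (\<lambda>(t, s). corr_coeff t * (s - t) powr (\<alpha> + 1))"
  "(\<lambda>(t, s). corr M (nabla d X t) (nabla d X s)) \<sim>[lag_to_zero d T] (\<lambda>(t, s). 1 - corr_coeff t * (s - t) powr (\<alpha> + 1))"
proof -
  define V where "V = sq_mean d - rate\<^sup>2 * d\<^sup>2"
  define c where "c = 2 * rate / (Gamma (\<alpha> + 2) * V)"
  \<comment> \<open>A second difference of \<open>\<lambda>r. r powr (\<alpha> + 1)\<close> at the
    point \<open>d > 0\<close>, where this function is smooth.\<close>
  define D where "D h = (d + h) powr (\<alpha> + 1) - 2 * d powr (\<alpha> + 1) + (d - h) powr (\<alpha> + 1)" for h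
  define F where "F h = c * (h powr (\<alpha> + 1) - D h / 2)" for h
  have coeff: "\<forall>\<^sub>F (t, s) in lag_to_zero d T. c * (s - t) powr (\<alpha> + 1) = corr_coeff t * (s - t) powr (\<alpha> + 1)"
    using eventually_lag_to_zero
  proof eventually_elim
    case (elim p)
    obtain t s where p: "p = (t, s)" by fastforce
    have "var M (nabla d X t) = V" using elim d by (auto simp: p V_def intro!: var_nabla)
    hence "corr_coeff t = c" by (simp add: corr_coeff_def c_def rate_def)
    thus ?case by (simp add: p)
  qed
  have corr: "\<forall>\<^sub>F (t, s) in lag_to_zero d T. F (s - t) = 1 - corr M (nabla d X t) (nabla d X s)"
    using eventually_lag_to_zero
  proof eventually_elim
    case (elim p)
    obtain t s where p: "p = (t, s)" by fastforce
    have ts: "d \<le> t" "t < s" "s \<le> T" "s - t < d" using elim by (auto simp: p)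
    have V: "V > 0" unfolding V_def using d ts by (intro variance_pos) auto
    have "corr M (nabla d X t) (nabla d X s) =
        ((sq_mean (s - t + d) + sq_mean (d - (s - t)) - 2 * sq_mean (s - t)) / 2 - rate\<^sup>2 * d\<^sup>2) / V"
      unfolding V_def using d ts by (simp add: corr_nabla cov_nabla nabla_product(2) abs_if)
    \<comment> \<open>The term \<open>rate\<^sup>2 * d\<^sup>2\<close> is replaced by
      \<open>sq_mean d - V\<close>, which splits off the 1 and completes the second difference at
      \<open>d\<close>.\<close>
    also have "\<dots> = 1 + ((sq_mean (s - t + d) + sq_mean (d - (s - t)) - 2 * sq_mean d) / 2 - sq_mean (s - t)) / V"
      using V by (simp add: field_simps) (simp add: V_def field_simps)
    also have "\<dots> = 1 - F (s - t)"
      using V Gamma_pos by (simp add: F_def D_def c_def sq_mean_def field_simps)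
    finally show ?case by (simp add: p)
  qed
  \<comment> \<open>The second difference is of order \<open>h ^ 2\<close>, negligible because
    \<open>\<alpha> + 1 < 2\<close>.\<close>
  have "((\<lambda>h. D h / h powr (\<alpha> + 1)) \<longlongrightarrow> 0) (at_right 0)"
    unfolding D_def using d \<alpha> by real_asymp
  hence "((\<lambda>h. 1 - D h / h powr (\<alpha> + 1) / 2) \<longlongrightarrow> 1 - 0 / 2) (at_right 0)"
    by (intro tendsto_intros) auto
  hence lim: "((\<lambda>h. 1 - D h / h powr (\<alpha> + 1) / 2) \<longlongrightarrow> 1) (at_right 0)" by simp
  have F0: "(F \<longlongrightarrow> 0) (at_right 0)"
    unfolding F_def D_def using d \<alpha> by real_asymp
  have P0: "((\<lambda>h. c * h powr (\<alpha> + 1)) \<longlongrightarrow> 0) (at_right 0)"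
    using \<alpha> by real_asymp
  show "(\<lambda>(t, s). 1 - corr M (nabla d X t) (nabla d X s)) \<sim>[lag_to_zero d T] (\<lambda>(t, s). corr_coeff t * (s - t) powr (\<alpha> + 1))"
  proof (cases "d < T")
    case True
    have "V > 0" unfolding V_def using d True by (intro variance_pos) auto
    hence c: "c \<noteq> 0" using rate_pos Gamma_pos by (simp add: c_def)
    have "F \<sim>[at_right 0] (\<lambda>h. c * h powr (\<alpha> + 1))"
    proof (rule asymp_equivI')
      show "((\<lambda>h. F h / (c * h powr (\<alpha> + 1))) \<longlongrightarrow> 1) (at_right 0)"
        by (rule Lim_transform_eventually[OF lim], rule eventually_at_right_less[THEN eventually_mono])
          (use c in \<open>simp add: F_def diff_divide_distrib\<close>)
    qed
    from asymp_equiv_compose'[OF this filterlim_lag]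
    show ?thesis
      by (rule asymp_equiv_transfer) (use corr coeff in \<open>auto simp: case_prod_unfold\<close>)
  qed (simp add: lag_to_zero_eq_bot asymp_equiv_def)
  show "(\<lambda>(t, s). corr M (nabla d X t) (nabla d X s)) \<sim>[lag_to_zero d T] (\<lambda>(t, s). 1 - corr_coeff t * (s - t) powr (\<alpha> + 1))"
  proof (rule asymp_equiv_transfer)
    have "((\<lambda>h. 1 - F h) \<longlongrightarrow> 1 - 0) (at_right 0)" "((\<lambda>h. 1 - c * h powr (\<alpha> + 1)) \<longlongrightarrow> 1 - 0) (at_right 0)"
      by (intro tendsto_diff tendsto_const F0 P0)+
    from this[THEN tendsto_imp_asymp_equiv_const]
    have "(\<lambda>h. 1 - F h) \<sim>[at_right 0] (\<lambda>h. 1 - c * h powr (\<alpha> + 1))"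
      by (auto intro: asymp_equiv_trans asymp_equiv_symI)
    from asymp_equiv_compose'[OF this filterlim_lag]
    show "(\<lambda>p. 1 - F (case p of (t, s) \<Rightarrow> s - t)) \<sim>[lag_to_zero d T] (\<lambda>p. 1 - c * (case p of (t, s) \<Rightarrow> s - t) powr (\<alpha> + 1))" .
  qed (use corr coeff in \<open>auto simp: case_prod_unfold elim: eventually_mono\<close>)
qed

end

end

theorem proposition3p11:
  fixes M :: "'a measure" and X :: "real \<Rightarrow> 'a \<Rightarrow> real" and \<alpha> b T :: real
  assumes "0 < \<alpha>" "\<alpha> < 1" "0 < b" "b \<le> 1" "0 < T"
    and "mittag_leffler_process M \<alpha> b T X"
  shows
    "(\<forall>d t s. 0 < d \<and> d \<le> t \<and> t < s \<and> s \<le> T \<and> s - t > d \<longrightarrow>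
        (LINT \<omega>|M. nabla d X t \<omega> * nabla d X s \<omega>) =
          b * T powr (\<alpha> - 1) / (Gamma \<alpha> * Gamma (\<alpha> + 2)) *
          ((s - t + d) powr (\<alpha> + 1) - 2 * (s - t) powr (\<alpha> + 1) + (s - t - d) powr (\<alpha> + 1)))
     \<and>
     (\<forall>t s. 0 < t \<and> t < s \<and> s \<le> T \<longrightarrow>
        (let c' = b * T powr (\<alpha> - 1) / (Gamma \<alpha>)\<^sup>2; c'' = 2 / (\<alpha> * (\<alpha> + 1)) in
          (\<lambda>\<Delta>. LINT \<omega>|M. nabla \<Delta> X t \<omega> * nabla \<Delta> X s \<omega>)
             \<sim>[at_right 0] (\<lambda>\<Delta>. \<Delta>\<^sup>2 * c' * (s - t) powr (\<alpha> - 1))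
          \<and>
          (\<lambda>\<Delta>. cov M (nabla \<Delta> X t) (nabla \<Delta> X s))
             \<sim>[at_right 0] (\<lambda>\<Delta>. \<Delta>\<^sup>2 * c' * ((s - t) powr (\<alpha> - 1) - b * T powr (\<alpha> - 1)))
          \<and>
          (\<lambda>\<Delta>. corr M (nabla \<Delta> X t) (nabla \<Delta> X s))
             \<sim>[at_right 0] (\<lambda>\<Delta>. ((s - t) powr (\<alpha> - 1) - b * T powr (\<alpha> - 1)) /
                                    (c'' * \<Delta> powr (\<alpha> - 1) - b * T powr (\<alpha> - 1)))))
     \<and>
     (\<forall>d>0.
        let c' = (\<lambda>t. 2 * b * T powr (\<alpha> - 1) /
                      (Gamma \<alpha> * Gamma (\<alpha> + 2) * var M (nabla d X t))) in
          (\<lambda>(t, s). corr M (nabla d X t) (nabla d X s))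
             \<sim>[lag_to_zero d T] (\<lambda>(t, s). 1 - c' t * (s - t) powr (\<alpha> + 1))
          \<and>
          (\<lambda>(t, s). 1 - corr M (nabla d X t) (nabla d X s))
             \<sim>[lag_to_zero d T] (\<lambda>(t, s). c' t * (s - t) powr (\<alpha> + 1)))
     \<and>
     (\<forall>(m::nat) (t::nat \<Rightarrow> real) (k::nat \<Rightarrow> nat).
        1 \<le> m \<and> 0 < t 1 \<and> strict_mono_on {1..m} t \<and> t m \<le> T \<and> (\<forall>i\<in>{1..m}. 1 \<le> k i) \<longrightarrow>
        (let c' = b * T powr (\<alpha> - 1) in
          ((\<lambda>d. (LINT \<omega>|M. (\<Prod>i=1..m. nabla d X (t i) \<omega> ^ k i)) /
                (\<Prod>i=1..m. (LINT \<omega>|M. nabla d X (t i) \<omega> ^ k i)))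
             \<longlongrightarrow> (\<Prod>i=2..m. (t i - t (i - 1)) powr (\<alpha> - 1) / c')) (at_right 0)))"
proof -
  interpret mittag_leffler M \<alpha> b T X
    using assms by (rule mittag_leffler.intro)
  show ?thesis
    unfolding Let_def
  proof (intro conjI allI impI)
    fix d t s
    assume "0 < d \<and> d \<le> t \<and> t < s \<and> s \<le> T \<and> s - t > d"
    thus "(LINT \<omega>|M. nabla d X t \<omega> * nabla d X s \<omega>) =
        b * T powr (\<alpha> - 1) / (Gamma \<alpha> * Gamma (\<alpha> + 2)) *
        ((s - t + d) powr (\<alpha> + 1) - 2 * (s - t) powr (\<alpha> + 1) + (s - t - d) powr (\<alpha> + 1))"
      by (intro nabla_product_closed_form) auto
  next
    fix t s
    assume "0 < t \<and> t < s \<and> s \<le> T"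
    hence ts: "0 < t" "t < s" "s \<le> T" by auto
    note nabla_product_asymp[OF ts] cov_nabla_asymp[OF ts] corr_nabla_asymp[OF ts]
    thus "(\<lambda>\<Delta>. LINT \<omega>|M. nabla \<Delta> X t \<omega> * nabla \<Delta> X s \<omega>)
          \<sim>[at_right 0] (\<lambda>\<Delta>. \<Delta>\<^sup>2 * (b * T powr (\<alpha> - 1) / (Gamma \<alpha>)\<^sup>2) * (s - t) powr (\<alpha> - 1))"
      and "(\<lambda>\<Delta>. cov M (nabla \<Delta> X t) (nabla \<Delta> X s))
          \<sim>[at_right 0] (\<lambda>\<Delta>. \<Delta>\<^sup>2 * (b * T powr (\<alpha> - 1) / (Gamma \<alpha>)\<^sup>2) * ((s - t) powr (\<alpha> - 1) - b * T powr (\<alpha> - 1)))"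
      and "(\<lambda>\<Delta>. corr M (nabla \<Delta> X t) (nabla \<Delta> X s))
          \<sim>[at_right 0] (\<lambda>\<Delta>. ((s - t) powr (\<alpha> - 1) - b * T powr (\<alpha> - 1)) /
            (2 / (\<alpha> * (\<alpha> + 1)) * \<Delta> powr (\<alpha> - 1) - b * T powr (\<alpha> - 1)))"
      by blast+
  next
    fix d :: real
    assume d: "0 < d"
    show "(\<lambda>(t, s). corr M (nabla d X t) (nabla d X s)) \<sim>[lag_to_zero d T]
        (\<lambda>(t, s). 1 - 2 * b * T powr (\<alpha> - 1) / (Gamma \<alpha> * Gamma (\<alpha> + 2) * var M (nabla d X t)) * (s - t) powr (\<alpha> + 1))"
      using corr_lag_to_zero(2)[OF d] by (simp only: corr_coeff_def[OF d])
    show "(\<lambda>(t, s). 1 - corr M (nabla d X t) (nabla d X s)) \<sim>[lag_to_zero d T]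
        (\<lambda>(t, s). 2 * b * T powr (\<alpha> - 1) / (Gamma \<alpha> * Gamma (\<alpha> + 2) * var M (nabla d X t)) * (s - t) powr (\<alpha> + 1))"
      using corr_lag_to_zero(1)[OF d] by (simp only: corr_coeff_def[OF d])
  next
    fix m :: nat and t :: "nat \<Rightarrow> real" and k :: "nat \<Rightarrow> nat"
    assume "1 \<le> m \<and> 0 < t 1 \<and> strict_mono_on {1..m} t \<and> t m \<le> T \<and> (\<forall>i\<in>{1..m}. 1 \<le> k i)"
    thus "((\<lambda>d. (LINT \<omega>|M. (\<Prod>i=1..m. nabla d X (t i) \<omega> ^ k i)) / (\<Prod>i=1..m. (LINT \<omega>|M. nabla d X (t i) \<omega> ^ k i)))
        \<longlongrightarrow> (\<Prod>i=2..m. (t i - t (i - 1)) powr (\<alpha> - 1) / (b * T powr (\<alpha> - 1)))) (at_right 0)"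
      by (intro joint_moment_ratio_tendsto) auto
  qed
qed

end
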